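(* Let $H=\frac12$, assume that $\Theta\subset\mathbb R^q$ is compact and that $\{b_\vartheta\}_{\vartheta\in\Theta}$ satisfies the weak coercivity condition, and let $\nu_\vartheta$ be the invariant measure corresponding to the drift $b_\vartheta$. Let $\vartheta_1,\vartheta_2\in\Theta$ and set $$F=\mathrm{Span}\{\nabla f:\ f\in\mathcal C^2(\mathbb R^d,\mathbb R)\text{ with compact support}\},$$ considered as a subspace of $L^2(\nu_{\vartheta_1})$. Assume that $b_{\vartheta_1}-b_{\vartheta_2}$ is not an element of $F^\perp$ in $L^2(\nu_{\vartheta_1})$. Then $d(\nu_{\vartheta_1},\nu_{\vartheta_2})>0$, where $d$ is any distance on $\mathcal M_1(\mathbb R^d)$. If this condition is satisfied for all couples $(\vartheta_1,\vartheta_2)\in\Theta^2$ with $\vartheta_1\ne\vartheta_2$, then the identifiability condition holds: for all $\vartheta\in\Theta$, $\nu_\vartheta=\nu_{\vartheta_0}$ if and only if $\vartheta=\vartheta_0$.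
   Context: $\sigma$ is an invertible $d\times d$ real matrix, $\Theta\subset\mathbb R^q$, $\vartheta_0\in\Theta$, $\{b_\vartheta:\mathbb R^d\to\mathbb R^d\}_{\vartheta\in\Theta}$ is a family of drifts. For $H=\frac12$ the equation considered is $dY^\vartheta_t=b_\vartheta(Y^\vartheta_t)dt+\sigma dB_t$ with $B$ a $d$-dimensional Brownian (Wiener) process. Weak coercivity condition: $b\in\mathcal C^{1,1}(\mathbb R^d\times\Theta;\mathbb R^d)$ (where $b(x,\vartheta)=b_\vartheta(x)$) and there are constants $\alpha,\beta,C,L>0$ and $r\in\mathbb N$ such that for all $x,y\in\mathbb R^d$, $\vartheta\in\Theta$: $\langle b_\vartheta(x)-b_\vartheta(y),x-y\rangle\le\beta-\alpha|x-y|^2$, $|b_\vartheta(x)-b_\vartheta(y)|\le L|x-y|$, and $|\partial_\vartheta b_\vartheta(x)|\le C(1+|x|^r)$. Under it there is, for each $\vartheta$, a unique stationary law for the equation, and $\nu_\vartheta$ is its one-time marginal. $\mathcal M_1(\mathbb R^d)$ is the set of probability measures on $\mathbb R^d$; a distance on it is one metrizing weak convergence. *)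

theory Defs
  imports "HOL-Probability.Probability"
begin

section \<open>The weak coercivity condition\<close>

text \<open>
  The family of drifts is \<open>b :: real^'q \<Rightarrow> real^'d \<Rightarrow> real^'d\<close>, with the parameter as first
  argument.  Class \<open>C\<^sup>1\<^sup>,\<^sup>1\<close> on \<open>\<real>\<^sup>d \<times> \<Theta>\<close>: \<open>b\<close> and its two first-order partial derivatives are
  jointly continuous.  As \<open>\<Theta>\<close> need not be open, the derivative in the parameter is taken within
  \<open>\<Theta>\<close>; such a derivative need not be unique, so the derivatives are arguments of the predicate,
  and the growth bound of the coercivity condition refers to the same \<open>D\<theta>\<close>.
\<close>

definition C11_with_derivs ::
  "(real^'q) set \<Rightarrow> (real^'q \<Rightarrow> real^'d \<Rightarrow> real^'d) \<Rightarrow>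
   (real^'q \<Rightarrow> real^'d \<Rightarrow> (real^'d) \<Rightarrow>\<^sub>L (real^'d)) \<Rightarrow>
   (real^'q \<Rightarrow> real^'d \<Rightarrow> (real^'q) \<Rightarrow>\<^sub>L (real^'d)) \<Rightarrow> bool"
  where "C11_with_derivs \<Theta> b Dx D\<theta> \<longleftrightarrow>
    continuous_on (UNIV \<times> \<Theta>) (\<lambda>(x, \<theta>). b \<theta> x) \<and>
    (\<forall>\<theta>\<in>\<Theta>. \<forall>x. (b \<theta> has_derivative blinfun_apply (Dx \<theta> x)) (at x)) \<and>
    continuous_on (UNIV \<times> \<Theta>) (\<lambda>(x, \<theta>). Dx \<theta> x) \<and>
    (\<forall>\<theta>\<in>\<Theta>. \<forall>x. ((\<lambda>\<eta>. b \<eta> x) has_derivative blinfun_apply (D\<theta> \<theta> x)) (at \<theta> within \<Theta>)) \<and>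
    continuous_on (UNIV \<times> \<Theta>) (\<lambda>(x, \<theta>). D\<theta> \<theta> x)"

definition weak_coercivity ::
  "(real^'q) set \<Rightarrow> (real^'q \<Rightarrow> real^'d \<Rightarrow> real^'d) \<Rightarrow> bool"
  where "weak_coercivity \<Theta> b \<longleftrightarrow>
    (\<exists>Dx D\<theta>. C11_with_derivs \<Theta> b Dx D\<theta> \<and>
      (\<exists>\<alpha> \<beta> C L :: real. \<exists>r :: nat. \<alpha> > 0 \<and> \<beta> > 0 \<and> C > 0 \<and> L > 0 \<and>
        (\<forall>x y. \<forall>\<theta>\<in>\<Theta>.
          (b \<theta> x - b \<theta> y) \<bullet> (x - y) \<le> \<beta> - \<alpha> * (norm (x - y))\<^sup>2 \<and>
          norm (b \<theta> x - b \<theta> y) \<le> L * norm (x - y) \<and>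
          norm (D\<theta> \<theta> x) \<le> C * (1 + norm x ^ r))))"

section \<open>Stationary solutions of the equation\<close>

text \<open>
  The library's \<open>indep_var\<close> only relates random variables with values in the same type; the
  following is its characterization by generated \<open>\<sigma>\<close>-algebras, for arbitrary value types.
\<close>

definition independent_rvs ::
  "'w measure \<Rightarrow> 'a measure \<Rightarrow> ('w \<Rightarrow> 'a) \<Rightarrow> 'b measure \<Rightarrow> ('w \<Rightarrow> 'b) \<Rightarrow> bool"
  where "independent_rvs P M X N Z \<longleftrightarrow>
    X \<in> P \<rightarrow>\<^sub>M M \<and> Z \<in> P \<rightarrow>\<^sub>M N \<and>
    prob_space.indep_set P {X -` A \<inter> space P | A. A \<in> sets M} {Z -` A \<inter> space P | A. A \<in> sets N}"

definition brownian_motion :: "'w measure \<Rightarrow> (real \<Rightarrow> 'w \<Rightarrow> real^'d) \<Rightarrow> bool"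
  where "brownian_motion P B \<longleftrightarrow>
    prob_space P \<and>
    (\<forall>t\<ge>0. B t \<in> borel_measurable P) \<and>
    (AE \<omega> in P. B 0 \<omega> = 0 \<and> continuous_on {0..} (\<lambda>t. B t \<omega>)) \<and>
    (\<forall>s\<ge>0. \<forall>t>s.
      independent_rvs P borel (\<lambda>\<omega>. B t \<omega> - B s \<omega>)
        (\<Pi>\<^sub>M u\<in>{0..s}. borel) (\<lambda>\<omega>. \<lambda>u\<in>{0..s}. B u \<omega>) \<and>
      prob_space.indep_vars P (\<lambda>i. borel) (\<lambda>i \<omega>. (B t \<omega> - B s \<omega>) $ i) UNIV \<and>
      (\<forall>i. distributed P lborel (\<lambda>\<omega>. (B t \<omega> - B s \<omega>) $ i) (normal_density 0 (sqrt (t - s)))))"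

text \<open>
  The noise is additive, so \<open>dY\<^sub>t = b(Y\<^sub>t) dt + \<sigma> dB\<^sub>t\<close> is the integral equation below, with a
  pathwise integral.  The initial value is independent of the driving Brownian motion, as for
  every solution adapted to a filtration for which \<open>B\<close> is a Brownian motion.
\<close>

definition sde_solution ::
  "'w measure \<Rightarrow> (real \<Rightarrow> 'w \<Rightarrow> real^'d) \<Rightarrow> real^'d^'d \<Rightarrow> (real^'d \<Rightarrow> real^'d) \<Rightarrow>
   (real \<Rightarrow> 'w \<Rightarrow> real^'d) \<Rightarrow> bool"
  where "sde_solution P B \<sigma> f Y \<longleftrightarrow>
    brownian_motion P B \<and>
    (\<forall>t\<ge>0. Y t \<in> borel_measurable P) \<and>
    independent_rvs P borel (Y 0) (\<Pi>\<^sub>M t\<in>{0..}. borel) (\<lambda>\<omega>. \<lambda>t\<in>{0..}. B t \<omega>) \<and>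
    (AE \<omega> in P. continuous_on {0..} (\<lambda>t. Y t \<omega>) \<and>
      (\<forall>t\<ge>0. Y t \<omega> = Y 0 \<omega> + integral {0..t} (\<lambda>s. f (Y s \<omega>)) + \<sigma> *v B t \<omega>))"

definition stationary_process :: "'w measure \<Rightarrow> (real \<Rightarrow> 'w \<Rightarrow> real^'d) \<Rightarrow> bool"
  where "stationary_process P Y \<longleftrightarrow>
    (\<forall>h\<ge>0. distr P (\<Pi>\<^sub>M t\<in>{0..}. borel) (\<lambda>\<omega>. \<lambda>t\<in>{0..}. Y (t + h) \<omega>) =
            distr P (\<Pi>\<^sub>M t\<in>{0..}. borel) (\<lambda>\<omega>. \<lambda>t\<in>{0..}. Y t \<omega>))"

definition stationary_solution ::
  "'w measure \<Rightarrow> (real \<Rightarrow> 'w \<Rightarrow> real^'d) \<Rightarrow> real^'d^'d \<Rightarrow> (real^'d \<Rightarrow> real^'d) \<Rightarrow>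
   (real \<Rightarrow> 'w \<Rightarrow> real^'d) \<Rightarrow> bool"
  where "stationary_solution P B \<sigma> f Y \<longleftrightarrow> sde_solution P B \<sigma> f Y \<and> stationary_process P Y"

section \<open>The space \<open>F\<close> and orthogonality in \<open>L\<^sup>2(\<nu>)\<close>\<close>

definition gradient :: "(real^'d \<Rightarrow> real) \<Rightarrow> real^'d \<Rightarrow> real^'d"
  where "gradient f x = (THE D. GDERIV f x :> D)"

definition C2_fun :: "(real^'d \<Rightarrow> real) \<Rightarrow> bool"
  where "C2_fun f \<longleftrightarrow>
    (\<forall>x. f differentiable (at x)) \<and>
    (\<exists>H :: real^'d \<Rightarrow> (real^'d) \<Rightarrow>\<^sub>L (real^'d).
      (\<forall>x. (gradient f has_derivative blinfun_apply (H x)) (at x)) \<and> continuous_on UNIV H)"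

text \<open>
  Finite linear combinations are written out because the function type is not an instance of
  \<^class>\<open>real_vector\<close>, which \<open>span\<close> requires.
\<close>

definition fun_span :: "('a \<Rightarrow> 'b::real_vector) set \<Rightarrow> ('a \<Rightarrow> 'b) set"
  where "fun_span G = {\<lambda>x. \<Sum>g\<in>T. c g *\<^sub>R g x | T c. finite T \<and> T \<subseteq> G}"

definition grad_space :: "(real^'d \<Rightarrow> real^'d) set"
  where "grad_space = fun_span {gradient f | f. C2_fun f \<and> compact (closure {x. f x \<noteq> 0})}"

text \<open>
  Elements of \<open>L\<^sup>2\<close> are represented by functions; membership in either set below is invariant
  under almost-everywhere equality.
\<close>

definition L2_space :: "(real^'d) measure \<Rightarrow> (real^'d \<Rightarrow> real^'d) set"
  where "L2_space \<nu> = {g. g \<in> borel_measurable \<nu> \<and> integrable \<nu> (\<lambda>x. (norm (g x))\<^sup>2)}"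

definition L2_orthogonal ::
  "(real^'d) measure \<Rightarrow> (real^'d \<Rightarrow> real^'d) set \<Rightarrow> (real^'d \<Rightarrow> real^'d) set"
  where "L2_orthogonal \<nu> F = {g \<in> L2_space \<nu>. \<forall>h\<in>F. (\<integral>x. g x \<bullet> h x \<partial>\<nu>) = 0}"

section \<open>Distances on the set of probability measures\<close>

definition weakly_converges :: "(nat \<Rightarrow> (real^'d) measure) \<Rightarrow> (real^'d) measure \<Rightarrow> bool"
  where "weakly_converges \<mu>s \<mu> \<longleftrightarrow>
    (\<forall>f :: real^'d \<Rightarrow> real. continuous_on UNIV f \<and> bounded (range f) \<longrightarrow>
      (\<lambda>n. \<integral>x. f x \<partial>\<mu>s n) \<longlonglongrightarrow> (\<integral>x. f x \<partial>\<mu>))"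

text \<open>
  The underlying set \<open>space (prob_algebra borel)\<close> consists of the Borel probability measures.
\<close>

definition distance_on_prob :: "((real^'d) measure \<Rightarrow> (real^'d) measure \<Rightarrow> real) \<Rightarrow> bool"
  where "distance_on_prob dst \<longleftrightarrow>
    Metric_space (space (prob_algebra borel)) dst \<and>
    (\<forall>\<mu>s \<mu>. (\<forall>n. \<mu>s n \<in> space (prob_algebra borel)) \<and> \<mu> \<in> space (prob_algebra borel) \<longrightarrow>
      (limitin (Metric_space.mtopology (space (prob_algebra borel)) dst) \<mu>s \<mu> sequentially
        \<longleftrightarrow> weakly_converges \<mu>s \<mu>))"

end

theory Submission
  imports Defs
begin

text \<open>
  If two parameters have the same invariant measure \<open>\<nu>\<close>, the generators \<open>L\<^sub>i f = b\<^sub>i \<bullet> \<nabla>f + 1/2 tr(\<sigma>\<sigma>\<^sup>T \<nabla>\<^sup>2f)\<close>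
  satisfy \<open>\<integral> L\<^sub>i f d\<nu> = 0\<close>, and as the second-order parts coincide, \<open>\<integral> (b\<^sub>1 - b\<^sub>2) \<bullet> \<nabla>f d\<nu> = 0\<close>.
  No stochastic calculus is needed, because the second-order part need not be computed: compare
  \<open>f(Y\<^sub>t)\<close>, whose mean is \<open>\<integral> f d\<nu>\<close>, with \<open>f(Y\<^sub>0 + \<sigma>B\<^sub>t)\<close>, whose mean depends only on \<open>\<nu>\<close> and \<open>t\<close> by
  independence.  As \<open>Y\<^sub>t - (Y\<^sub>0 + \<sigma>B\<^sub>t) = \<integral>\<^sub>0\<^sup>t b(Y\<^sub>s) ds\<close>, the difference of the means divided by \<open>t\<close> tends to
  \<open>\<integral> \<nabla>f \<bullet> b d\<nu>\<close> for \<open>t \<rightarrow> 0\<close>.  Integrability of \<open>|x|\<^sup>2\<close> under \<open>\<nu>\<close> comes from a pathwise Gronwall bound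
  \<open>|Y\<^sub>1|\<^sup>2 \<le> \<rho> |Y\<^sub>0|\<^sup>2 + R\<close> with \<open>\<rho> < 1\<close> and \<open>R\<close> integrable, where \<open>Y\<^sub>0\<close> and \<open>Y\<^sub>1\<close> have the same law.
\<close>

section \<open>Tools from analysis: time integrals of processes, convergence of means, Gronwall,
  difference quotients\<close>

lemma riemann_sums_tendsto_integral:
  fixes g :: "real \<Rightarrow> real"
  assumes T: "0 < T" and g: "continuous_on {0..T} g"
  shows "(\<lambda>n. \<Sum>k<n. T / real n * g (real k * T / real n)) \<longlonglongrightarrow> integral {0..T} g"
proof (rule LIMSEQ_I)
  fix e :: real assume e: "0 < e"
  \<comment> \<open>The local errors add up to \<open>e' * T\<close>, which is half of
    \<open>e\<close> and hence strictly below it.\<close>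
  define e' where "e' = e / (2 * T)"
  have e': "0 < e'" using e T by (simp add: e'_def)
  have "uniformly_continuous_on {0..T} g"
    using g by (intro compact_uniformly_continuous) auto
  then obtain d where d: "0 < d"
    "\<And>x y. x \<in> {0..T} \<Longrightarrow> y \<in> {0..T} \<Longrightarrow> dist y x < d \<Longrightarrow> dist (g y) (g x) < e'"
    using e' unfolding uniformly_continuous_on_def by metis
  obtain N :: nat where N: "T / d < real N" using reals_Archimedean2 by blast
  have local_error: "\<bar>integral {0..y} g - integral {0..x} g - (y - x) * g x\<bar> \<le> e' * (y - x)"
    if xy: "0 \<le> x" "x \<le> y" "y \<le> T" "y - x < d" for x y
  proof -
    have int: "g integrable_on {x..y}" "g integrable_on {0..y}"
      using g xy by (auto intro!: integrable_continuous_interval continuous_on_subset[OF g])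
    have "integral {0..x} g + integral {x..y} g = integral {0..y} g"
      using xy int by (intro Henstock_Kurzweil_Integration.integral_combine) auto
    moreover have "integral {x..y} (\<lambda>s. g s - g x) = integral {x..y} g - (y - x) * g x"
      using int xy by (subst integral_diff) auto
    moreover have "norm (integral {x..y} (\<lambda>s. g s - g x)) \<le> e' * (y - x)"
    proof (rule integral_bound)
      show "continuous_on {x..y} (\<lambda>s. g s - g x)"
        using xy by (intro continuous_intros continuous_on_subset[OF g]) auto
      show "norm (g s - g x) \<le> e'" if "s \<in> {x..y}" for s
        using d(2)[of x s] that xy by (force simp: dist_norm)
    qed (use xy in auto)
    ultimately show ?thesis by simp
  qed
  show "\<exists>no. \<forall>n\<ge>no. norm ((\<Sum>k<n. T / real n * g (real k * T / real n)) - integral {0..T} g) < e"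
  proof (intro exI allI impI)
    \<comment> \<open>\<open>N\<close> makes the mesh \<open>T / n\<close> smaller than
      \<open>d\<close>; the 1 excludes \<open>n = 0\<close>, where the mesh would be 0 by
      convention.\<close>
    fix n assume n: "max 1 N \<le> n"
    define h where "h = T / real n"
    have h: "0 < h" "h < d" "real n * h = T"
    proof -
      show "0 < h" "real n * h = T" using T n by (auto simp: h_def)
      have "T < d * real N" using N d by (simp add: field_simps)
      also have "\<dots> \<le> d * real n" using n d by simp
      finally show "h < d" using n by (simp add: h_def field_simps)
    qed
    have "integral {0..T} g = (\<Sum>k<n. integral {0..real (Suc k) * h} g - integral {0..real k * h} g)"
      using h by (subst sum_lessThan_telescope) auto
    then have "norm ((\<Sum>k<n. h * g (real k * h)) - integral {0..T} g) =
      norm (\<Sum>k<n. h * g (real k * h) - (integral {0..real (Suc k) * h} g - integral {0..real k * h} g))"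
      by (simp add: sum_subtractf)
    also have "\<dots> \<le> (\<Sum>k<n. e' * h)"
    proof (rule order_trans[OF norm_sum sum_mono])
      fix k assume "k \<in> {..<n}"
      then have "real (Suc k) \<le> real n" by (simp only: of_nat_le_iff lessThan_iff Suc_le_eq)
      then have "real (Suc k) * h \<le> T" using h by (metis mult_right_mono less_imp_le)
      moreover have "real (Suc k) * h - real k * h = h" by (simp add: algebra_simps)
      ultimately show "norm (h * g (real k * h) -
          (integral {0..real (Suc k) * h} g - integral {0..real k * h} g)) \<le> e' * h"
        using local_error[of "real k * h" "real (Suc k) * h"] h
        by (auto simp: abs_minus_commute algebra_simps)
    qed
    also have "\<dots> = e' * T" using h by (simp add: algebra_simps)
    also have "\<dots> < e" using e T by (simp add: e'_def)
    finally show "norm ((\<Sum>k<n. T / real n * g (real k * T / real n)) - integral {0..T} g) < e"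
      by (simp add: h_def)
  qed
qed

text \<open>Measurability is given for each \<open>X t\<close> separately, and paths are continuous
  only off a null set, so the path integral need not be measurable in \<omega>. Riemann sums are
  finite combinations of random variables: their limit \<open>A\<close> is a measurable version of
  the integral, and Fatou's lemma bounds its mean, since each sum has mean at most
  \<open>T * c\<close>. This avoids joint measurability and Fubini.\<close>

lemma time_integral_nn_integral_le:
  fixes X :: "real \<Rightarrow> 'w \<Rightarrow> real"
  assumes T: "0 < T"
    and meas: "\<And>t. t \<in> {0..T} \<Longrightarrow> X t \<in> borel_measurable M"
    and cont: "AE \<omega> in M. continuous_on {0..T} (\<lambda>t. X t \<omega>)"
    and nonneg: "\<And>t \<omega>. 0 \<le> X t \<omega>"
    and bound: "\<And>t. t \<in> {0..T} \<Longrightarrow> (\<integral>\<^sup>+\<omega>. ennreal (X t \<omega>) \<partial>M) \<le> c"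
  obtains A where "A \<in> borel_measurable M" "AE \<omega> in M. A \<omega> = integral {0..T} (\<lambda>t. X t \<omega>)"
    "(\<integral>\<^sup>+\<omega>. ennreal (A \<omega>) \<partial>M) \<le> ennreal T * c"
proof -
  define S where "S n \<omega> = (\<Sum>k<n. T / real n * X (real k * T / real n) \<omega>)" for n \<omega>
  have grid: "real k * T / real n \<in> {0..T}" if "k < n" for k n
    using that T by (auto simp: field_simps)
  have S_meas [measurable]: "S n \<in> borel_measurable M" for n
    unfolding S_def using grid
    by (intro borel_measurable_sum borel_measurable_times borel_measurable_const meas) auto
  \<comment> \<open>\<open>lim\<close> takes one fixed value at all \<omega> where the sums diverge,
    so \<open>A\<close> is measurable on the whole space.\<close>
  define A where "A \<omega> = lim (\<lambda>n. S n \<omega>)" for \<omega>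
  have lim: "AE \<omega> in M. (\<lambda>n. S n \<omega>) \<longlonglongrightarrow> integral {0..T} (\<lambda>t. X t \<omega>)"
    using cont by eventually_elim (unfold S_def, erule riemann_sums_tendsto_integral[OF T])
  have A: "AE \<omega> in M. A \<omega> = integral {0..T} (\<lambda>t. X t \<omega>)"
    using lim by eventually_elim (auto simp: A_def intro: limI)
  have "(\<integral>\<^sup>+\<omega>. ennreal (A \<omega>) \<partial>M) = (\<integral>\<^sup>+\<omega>. liminf (\<lambda>n. ennreal (S n \<omega>)) \<partial>M)"
  proof (rule nn_integral_cong_AE)
    show "AE \<omega> in M. ennreal (A \<omega>) = liminf (\<lambda>n. ennreal (S n \<omega>))"
      using lim A
    proof eventually_elim
      case (elim \<omega>)
      then have "(\<lambda>n. ennreal (S n \<omega>)) \<longlonglongrightarrow> ennreal (A \<omega>)" by (auto intro!: tendsto_ennrealI)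
      then show ?case by (intro lim_imp_Liminf[symmetric]) auto
    qed
  qed
  also have "\<dots> \<le> liminf (\<lambda>n. \<integral>\<^sup>+\<omega>. ennreal (S n \<omega>) \<partial>M)"
    by (intro nn_integral_liminf) auto
  also have "\<dots> \<le> liminf (\<lambda>n. ennreal T * c)"
  proof (intro Liminf_mono always_eventually allI)
    fix n
    have "(\<integral>\<^sup>+\<omega>. ennreal (S n \<omega>) \<partial>M) =
        (\<integral>\<^sup>+\<omega>. (\<Sum>k<n. ennreal (T / real n) * ennreal (X (real k * T / real n) \<omega>)) \<partial>M)"
      using T nonneg by (simp add: S_def ennreal_mult[symmetric])
    also have "\<dots> = (\<Sum>k<n. \<integral>\<^sup>+\<omega>. ennreal (T / real n) * ennreal (X (real k * T / real n) \<omega>) \<partial>M)"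
      using meas grid by (intro nn_integral_sum) auto
    also have "\<dots> = (\<Sum>k<n. ennreal (T / real n) * (\<integral>\<^sup>+\<omega>. ennreal (X (real k * T / real n) \<omega>) \<partial>M))"
      using meas grid by (intro sum.cong nn_integral_cmult) auto
    also have "\<dots> \<le> (\<Sum>k<n. ennreal (T / real n) * c)"
      using bound grid by (intro sum_mono mult_left_mono) auto
    also have "\<dots> = of_nat n * (ennreal (T / real n) * c)" by simp
    also have "\<dots> = ennreal (real n * (T / real n)) * c"
      using T by (subst ennreal_mult) (simp_all add: ennreal_of_nat_eq_real_of_nat mult.assoc)
    \<comment> \<open>An equality unless \<open>n = 0\<close>, where division by zero makes the left
      side 0.\<close>
    also have "\<dots> \<le> ennreal T * c"
      using T by (intro mult_right_mono ennreal_leI) auto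
    finally show "(\<integral>\<^sup>+\<omega>. ennreal (S n \<omega>) \<partial>M) \<le> ennreal T * c" .
  qed
  also have "\<dots> = ennreal T * c" by (simp add: Liminf_const)
  finally show thesis
    using A by (intro that[of A]) (auto simp: A_def[abs_def])
qed

text \<open>A form of Pratt's extension of dominated convergence. The time averages that will bound
  the difference quotients have no evident common integrable majorant, but their means never exceed
  the mean of their limit, and this takes the place of a fixed dominating function.\<close>

lemma dominated_convergence_varying_bound:
  fixes G :: "nat \<Rightarrow> 'w \<Rightarrow> real"
  assumes meas [measurable]: "\<And>n. G n \<in> borel_measurable M" "\<And>n. A n \<in> borel_measurable M"
      "g \<in> borel_measurable M"
    and a: "integrable M a"
    and bound: "\<And>n. AE \<omega> in M. \<bar>G n \<omega>\<bar> \<le> A n \<omega>"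
    and G: "AE \<omega> in M. (\<lambda>n. G n \<omega>) \<longlonglongrightarrow> g \<omega>"
    and A: "AE \<omega> in M. (\<lambda>n. A n \<omega>) \<longlonglongrightarrow> a \<omega>"
    and A_le: "\<And>n. (\<integral>\<^sup>+\<omega>. ennreal (A n \<omega>) \<partial>M) \<le> (\<integral>\<^sup>+\<omega>. ennreal (a \<omega>) \<partial>M)"
  shows "(\<lambda>n. \<integral>\<omega>. G n \<omega> \<partial>M) \<longlonglongrightarrow> (\<integral>\<omega>. g \<omega> \<partial>M)"
proof -
  have [measurable]: "a \<in> borel_measurable M" using a by auto
  have bounds: "AE \<omega> in M. \<forall>n. \<bar>G n \<omega>\<bar> \<le> A n \<omega>" using bound by (simp add: AE_all_countable)
  have a_ge: "AE \<omega> in M. \<bar>g \<omega>\<bar> \<le> a \<omega>"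
    using bounds G A
  proof eventually_elim
    case (elim \<omega>)
    then show ?case
      by (intro tendsto_le[OF _ elim(3) tendsto_rabs[OF elim(2)]]) auto
  qed
  have a0: "AE \<omega> in M. 0 \<le> a \<omega>" using a_ge by eventually_elim auto
  have A0: "AE \<omega> in M. 0 \<le> A n \<omega>" for n using bound[of n] by eventually_elim auto
  have A_int: "integrable M (A n)" for n
  proof (rule integrableI_nonneg)
    have "(\<integral>\<^sup>+\<omega>. ennreal (a \<omega>) \<partial>M) = ennreal (\<integral>\<omega>. a \<omega> \<partial>M)" 
      using a a0 by (rule nn_integral_eq_integral)
    then show "(\<integral>\<^sup>+\<omega>. ennreal (A n \<omega>) \<partial>M) < \<infinity>"
      using A_le[of n] by (simp add: le_less_trans)
  qed (use A0 in auto)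
  have A_le': "(\<integral>\<omega>. A n \<omega> \<partial>M) \<le> (\<integral>\<omega>. a \<omega> \<partial>M)" for n
    using A_le[of n] nn_integral_eq_integral[OF a a0] nn_integral_eq_integral[OF A_int A0, of n]
      integral_nonneg_AE[OF a0] by (simp add: ennreal_le_iff)
  txt \<open>Truncating \<open>G n\<close> at \<open>m n = min (A n) a\<close> makes it dominated by \<open>a\<close>, at a cost of at most
    \<open>\<integral> (A n - m n) \<le> \<integral> (a - m n) \<longrightarrow> 0\<close>.\<close>
  define m where "m n \<omega> = min (A n \<omega>) (a \<omega>)" for n \<omega>
  define H where "H n \<omega> = max (- m n \<omega>) (min (G n \<omega>) (m n \<omega>))" for n \<omega>
  have [measurable]: "m n \<in> borel_measurable M" "H n \<in> borel_measurable M" for n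
    by (simp_all add: m_def[abs_def] H_def[abs_def])
  have m_lim: "(\<lambda>n. \<integral>\<omega>. m n \<omega> \<partial>M) \<longlonglongrightarrow> (\<integral>\<omega>. a \<omega> \<partial>M)"
  proof (rule integral_dominated_convergence[where w=a])
    show "AE \<omega> in M. (\<lambda>n. m n \<omega>) \<longlonglongrightarrow> a \<omega>"
      using A
    proof eventually_elim
      case (elim \<omega>)
      have "(\<lambda>n. m n \<omega>) \<longlonglongrightarrow> min (a \<omega>) (a \<omega>)"
        unfolding m_def by (intro tendsto_intros elim)
      then show ?case by simp
    qed
    show "AE \<omega> in M. norm (m n \<omega>) \<le> a \<omega>" for n
      using a0 A0[of n] by eventually_elim (auto simp: m_def)
  qed (use a in auto)
  have H_lim: "(\<lambda>n. \<integral>\<omega>. H n \<omega> \<partial>M) \<longlonglongrightarrow> (\<integral>\<omega>. g \<omega> \<partial>M)"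
  proof (rule integral_dominated_convergence[where w=a])
    show "AE \<omega> in M. (\<lambda>n. H n \<omega>) \<longlonglongrightarrow> g \<omega>"
      using A G a_ge
    proof eventually_elim
      case (elim \<omega>)
      have "(\<lambda>n. H n \<omega>) \<longlonglongrightarrow> max (- min (a \<omega>) (a \<omega>)) (min (g \<omega>) (min (a \<omega>) (a \<omega>)))"
        unfolding H_def m_def by (intro tendsto_intros elim)
      then show ?case using elim by (simp add: abs_le_iff min_absorb1 max_absorb2)
    qed
    show "AE \<omega> in M. norm (H n \<omega>) \<le> a \<omega>" for n
      using a0 A0[of n] by eventually_elim (auto simp: m_def H_def)
  qed (use a in auto)
  have G_int: "integrable M (G n)" for n
    by (rule Bochner_Integration.integrable_bound[OF A_int[of n]]) (use bound[of n] in auto)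
  have m_int: "integrable M (m n)" for n
    by (rule Bochner_Integration.integrable_bound[OF a]) (use a0 A0[of n] in \<open>auto simp: m_def\<close>)
  have H_int: "integrable M (H n)" for n
    by (rule Bochner_Integration.integrable_bound[OF a]) (use a0 A0[of n] in \<open>auto simp: m_def H_def\<close>)
  have err: "\<bar>(\<integral>\<omega>. G n \<omega> \<partial>M) - (\<integral>\<omega>. H n \<omega> \<partial>M)\<bar> \<le> (\<integral>\<omega>. a \<omega> \<partial>M) - (\<integral>\<omega>. m n \<omega> \<partial>M)" for n
  proof -
    have "\<bar>\<integral>\<omega>. G n \<omega> - H n \<omega> \<partial>M\<bar> \<le> (\<integral>\<omega>. \<bar>G n \<omega> - H n \<omega>\<bar> \<partial>M)" by (rule integral_abs_bound)
    also have "\<dots> \<le> (\<integral>\<omega>. A n \<omega> - m n \<omega> \<partial>M)"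
    proof (rule integral_mono_AE)
      \<comment> \<open>Where \<open>A n \<le> a\<close> nothing is cut off. Elsewhere
        \<open>G n\<close>, at most \<open>A n\<close> in modulus, is cut down to the level
        \<open>a\<close> and moves by at most \<open>A n - a\<close>.\<close>
      show "AE \<omega> in M. \<bar>G n \<omega> - H n \<omega>\<bar> \<le> A n \<omega> - m n \<omega>"
        using bound[of n] a0
      proof eventually_elim
        case (elim \<omega>)
        then show ?case by (cases "A n \<omega> \<le> a \<omega>") (auto simp: H_def m_def)
      qed
    qed (use G_int H_int A_int m_int in auto)
    also have "\<dots> \<le> (\<integral>\<omega>. a \<omega> \<partial>M) - (\<integral>\<omega>. m n \<omega> \<partial>M)"
      using A_le'[of n] A_int m_int by simp
    finally show ?thesis using G_int H_int by simp
  qed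
  have "(\<lambda>n. (\<integral>\<omega>. a \<omega> \<partial>M) - (\<integral>\<omega>. m n \<omega> \<partial>M)) \<longlonglongrightarrow> 0"
    using tendsto_diff[OF tendsto_const m_lim, of "\<integral>\<omega>. a \<omega> \<partial>M"] by simp
  then have "(\<lambda>n. (\<integral>\<omega>. G n \<omega> \<partial>M) - (\<integral>\<omega>. H n \<omega> \<partial>M)) \<longlonglongrightarrow> 0"
    by (rule Lim_null_comparison[OF always_eventually, rotated]) (use err in simp)
  from tendsto_add[OF this H_lim] show ?thesis by simp
qed

text \<open>The function \<open>v\<close> below does not increase: the factor
  \<open>exp (a * t)\<close> absorbs the damping, and the remaining \<open>exp (a * t) * k t\<close>
  is at most \<open>exp (a * T) * k t\<close> because \<open>k\<close> is nonnegative. Using the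
  constant weight \<open>exp (a * T)\<close> gives up some sharpness and leaves an unweighted
  integral of \<open>k\<close> at the end.\<close>

lemma dissipative_gronwall:
  fixes u :: "real \<Rightarrow> real"
  assumes T: "0 < T" and a: "0 \<le> a"
    and u: "\<And>t. t \<in> {0..T} \<Longrightarrow> (u has_real_derivative u' t) (at t within {0..T})"
    and le: "\<And>t. t \<in> {0..T} \<Longrightarrow> u' t \<le> - a * u t + k t"
    and k: "continuous_on {0..T} k" and k0: "\<And>t. 0 \<le> k t"
  shows "u T \<le> exp (- a * T) * u 0 + integral {0..T} k"
proof -
  define v where "v t = exp (a * t) * u t - exp (a * T) * integral {0..t} k" for t
  define v' where "v' t = a * exp (a * t) * u t + exp (a * t) * u' t - exp (a * T) * k t" for t
  have v: "(v has_real_derivative v' t) (at t within {0..T})" if t: "t \<in> {0..T}" for t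
  proof -
    have e: "((\<lambda>t. exp (a * t)) has_real_derivative a * exp (a * t)) (at t within {0..T})"
      by (auto intro!: derivative_eq_intros)
    show ?thesis
      using DERIV_diff[OF DERIV_mult[OF e u[OF t]]
          DERIV_cmult[OF integral_has_real_derivative[OF k t], of "exp (a * T)"]]
      by (simp add: v_def[abs_def] v'_def algebra_simps)
  qed
  have v'_le: "v' t \<le> 0" if t: "t \<in> {0..T}" for t
  proof -
    have "exp (a * t) * (a * u t + u' t) \<le> exp (a * t) * k t"
      using le[OF t] by (intro mult_left_mono) auto
    also have "\<dots> \<le> exp (a * T) * k t"
      using t a k0 by (intro mult_right_mono) (auto intro: mult_left_mono)
    finally show ?thesis by (simp add: v'_def algebra_simps)
  qed
  obtain t where t: "t \<in> {0<..<T}" "v T - v 0 = v' t * (T - 0)"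
    using mvt_simple[of 0 T v "\<lambda>t. (*) (v' t)"] T v by (auto simp: has_field_derivative_def)
  have "v' t * T \<le> 0" using v'_le[of t] t T by (intro mult_nonpos_nonneg) auto
  then have "exp (a * T) * u T \<le> u 0 + exp (a * T) * integral {0..T} k"
    using t by (simp add: v_def)
  then have "exp (- a * T) * (exp (a * T) * u T)
      \<le> exp (- a * T) * (u 0 + exp (a * T) * integral {0..T} k)"
    by (intro mult_left_mono) auto
  moreover have "exp (- a * T) * (exp (a * T) * z) = z" for z
    by (simp only: mult.assoc[symmetric] exp_add[symmetric]) simp
  ultimately show ?thesis by (simp only: distrib_left)
qed

lemma average_tendsto:
  fixes F :: "real \<Rightarrow> 'a::euclidean_space"
  assumes F: "continuous_on {0..} F"
  shows "(\<lambda>n. real (Suc n) *\<^sub>R integral {0..1 / real (Suc n)} F) \<longlonglongrightarrow> F 0"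
proof (rule LIMSEQ_I)
  fix e :: real assume e: "0 < e"
  then obtain d where d: "0 < d" "\<And>s. 0 \<le> s \<Longrightarrow> s < d \<Longrightarrow> norm (F s - F 0) < e / 2"
    using F[unfolded continuous_on_iff, rule_format, of 0 "e / 2"] by (auto simp: dist_norm)
  obtain N where N: "1 / real (Suc N) < d" using d(1) nat_approx_posE by metis
  show "\<exists>no. \<forall>n\<ge>no. norm (real (Suc n) *\<^sub>R integral {0..1 / real (Suc n)} F - F 0) < e"
  proof (intro exI allI impI)
    fix n assume "N \<le> n"
    define h where "h = 1 / real (Suc n)"
    have "h \<le> 1 / real (Suc N)" using \<open>N \<le> n\<close> by (simp add: h_def frac_le)
    then have h: "0 < h" "h < d" "real (Suc n) * h = 1"
      using N by (auto simp: h_def)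
    have F_h: "continuous_on {0..h} F" by (rule continuous_on_subset[OF F]) auto
    have "integral {0..h} (\<lambda>s. F s - F 0) = integral {0..h} F - h *\<^sub>R F 0"
      using F_h h by (subst integral_diff) (auto intro: integrable_continuous_interval)
    moreover have "norm (integral {0..h} (\<lambda>s. F s - F 0)) \<le> e / 2 * (h - 0)"
      using F_h h d by (intro integral_bound continuous_intros) (auto intro: less_imp_le)
    ultimately have "real (Suc n) * norm (integral {0..h} F - h *\<^sub>R F 0) \<le> real (Suc n) * (e / 2 * h)"
      by (intro mult_left_mono) auto
    also have "\<dots> = e / 2" using h(3) by (simp add: mult.left_commute)
    also have "\<dots> < e" using e by simp
    also have "real (Suc n) * norm (integral {0..h} F - h *\<^sub>R F 0) =
        norm (real (Suc n) *\<^sub>R (integral {0..h} F - h *\<^sub>R F 0))" by simp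
    also have "real (Suc n) *\<^sub>R (integral {0..h} F - h *\<^sub>R F 0) = real (Suc n) *\<^sub>R integral {0..h} F - F 0"
      using h(3) by (simp only: scaleR_diff_right scaleR_scaleR scaleR_one)
    finally show "norm (real (Suc n) *\<^sub>R integral {0..1 / real (Suc n)} F - F 0) < e"
      by (simp add: h_def)
  qed
qed

lemma gderiv_mean_value:
  fixes x d :: "'a::real_inner"
  assumes "\<And>y. GDERIV \<phi> y :> g y"
  obtains \<tau> where "\<tau> \<in> {0<..<1}" "\<phi> (x + d) - \<phi> x = g (x + \<tau> *\<^sub>R d) \<bullet> d"
proof -
  have line: "((\<lambda>s. x + s *\<^sub>R d) has_derivative (\<lambda>s. s *\<^sub>R d)) (at t within {0..1})" for t :: real
    by (auto intro!: derivative_eq_intros)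
  have "((\<lambda>s. \<phi> (x + s *\<^sub>R d)) has_derivative (\<lambda>s. (s *\<^sub>R d) \<bullet> g (x + t *\<^sub>R d))) (at t within {0..1})" for t
    using has_derivative_compose[OF line assms[unfolded gderiv_def]] .
  then obtain t where "t \<in> {0<..<1}"
    "\<phi> (x + 1 *\<^sub>R d) - \<phi> (x + 0 *\<^sub>R d) = ((1 - 0) *\<^sub>R d) \<bullet> g (x + t *\<^sub>R d)"
    using mvt_simple[of 0 1 "\<lambda>s. \<phi> (x + s *\<^sub>R d)" "\<lambda>t s. (s *\<^sub>R d) \<bullet> g (x + t *\<^sub>R d)"] by auto
  then show thesis by (intro that) (auto simp: inner_commute)
qed

text \<open>Both the base point and the increment vary with \<open>n\<close>, so differentiability
  at \<open>a\<close> alone would not suffice. The mean value theorem evaluates \<open>g\<close> at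
  a point between \<open>x n\<close> and \<open>x n + d n\<close>; such points tend to
  \<open>a\<close>, and continuity of \<open>g\<close> finishes.\<close>

lemma tendsto_difference_quotient_along_sequence:
  fixes x d :: "nat \<Rightarrow> 'a::real_inner" and c :: "nat \<Rightarrow> real"
  assumes \<phi>: "\<And>y. GDERIV \<phi> y :> g y" and g: "continuous_on UNIV g"
    and x: "x \<longlonglongrightarrow> a" and d: "(\<lambda>n. c n *\<^sub>R d n) \<longlonglongrightarrow> v" and d0: "d \<longlonglongrightarrow> 0"
  shows "(\<lambda>n. c n * (\<phi> (x n + d n) - \<phi> (x n))) \<longlonglongrightarrow> g a \<bullet> v"
proof -
  have "\<exists>\<tau>. \<tau> \<in> {0<..<1} \<and> \<phi> (x n + d n) - \<phi> (x n) = g (x n + \<tau> *\<^sub>R d n) \<bullet> d n" for n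
    using gderiv_mean_value[of \<phi> g "x n" "d n"] \<phi> by metis
  then obtain \<tau> :: "nat \<Rightarrow> real" where \<tau>: "\<And>n. \<tau> n \<in> {0<..<1}"
    "\<And>n. \<phi> (x n + d n) - \<phi> (x n) = g (x n + \<tau> n *\<^sub>R d n) \<bullet> d n" by metis
  have "(\<lambda>n. \<tau> n *\<^sub>R d n) \<longlonglongrightarrow> 0"
  proof (rule Lim_null_comparison[OF always_eventually])
    have "norm (\<tau> n *\<^sub>R d n) \<le> norm (d n)" for n
      using \<tau>(1)[of n] by (simp add: mult_left_le_one_le)
    then show "\<forall>n. norm (\<tau> n *\<^sub>R d n) \<le> norm (d n)" by blast
    show "(\<lambda>n. norm (d n)) \<longlonglongrightarrow> 0" using d0 by (rule tendsto_norm_zero)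
  qed
  from tendsto_add[OF x this] have "(\<lambda>n. x n + \<tau> n *\<^sub>R d n) \<longlonglongrightarrow> a" by simp
  then have "(\<lambda>n. g (x n + \<tau> n *\<^sub>R d n)) \<longlonglongrightarrow> g a"
    by (intro continuous_on_tendsto_compose[OF g]) auto
  from tendsto_inner[OF this d] show ?thesis
    by (simp add: \<tau>(2) inner_scaleR_right)
qed

section \<open>Finite second moments from contraction in law\<close>

lemma (in prob_space) integrable_if_contracting_in_law:
  fixes u v R :: "'a \<Rightarrow> real"
  assumes [measurable]: "u \<in> borel_measurable M" "v \<in> borel_measurable M"
    and u0: "\<And>\<omega>. 0 \<le> u \<omega>"
    and law: "distr M borel u = distr M borel v"
    and R: "integrable M R"
    and le: "AE \<omega> in M. 0 \<le> R \<omega> \<and> v \<omega> \<le> \<rho> * u \<omega> + R \<omega>"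
    and \<rho>: "0 \<le> \<rho>" "\<rho> < 1"
  shows "integrable M u"
proof -
  txt \<open>Since \<open>min v n \<le> min (\<rho> u) n + R\<close> and \<open>min u n\<close>, \<open>min v n\<close> have the same mean,
    \<open>E (min u n - min (\<rho> u) n) \<le> E R\<close>; let \<open>n \<rightarrow> \<infinity>\<close>.\<close>
  have u_min: "min (\<rho> * u \<omega>) c \<le> min (u \<omega>) c" for \<omega> c
    using u0[of \<omega>] \<rho> by (intro min.mono mult_left_le_one_le) auto
  \<comment> \<open>Nonnegativity is a property of the law, so it passes from \<open>u\<close> to
    \<open>v\<close>, though only almost surely.\<close>
  have v0: "AE \<omega> in M. 0 \<le> v \<omega>"
  proof -
    have "AE x in distr M borel u. 0 \<le> x" using u0 by (subst AE_distr_iff) auto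
    then show ?thesis unfolding law by (subst (asm) AE_distr_iff) auto
  qed
  have int: "integrable M (\<lambda>\<omega>. min (u \<omega>) (real n))" "integrable M (\<lambda>\<omega>. min (v \<omega>) (real n))"
    "integrable M (\<lambda>\<omega>. min (\<rho> * u \<omega>) (real n))" for n
    using u0 v0 \<rho> by (auto intro!: integrable_const_bound[where B="real n"])
  have "(\<integral>\<omega>. min (u \<omega>) (real n) - min (\<rho> * u \<omega>) (real n) \<partial>M) \<le> (\<integral>\<omega>. R \<omega> \<partial>M)" for n
  proof -
    have "(\<integral>\<omega>. min (u \<omega>) (real n) \<partial>M) = (\<integral>x. min x (real n) \<partial>distr M borel u)"
      by (subst integral_distr) auto
    also have "\<dots> = (\<integral>\<omega>. min (v \<omega>) (real n) \<partial>M)"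
      unfolding law by (subst integral_distr) auto
    also have "\<dots> \<le> (\<integral>\<omega>. min (\<rho> * u \<omega>) (real n) + R \<omega> \<partial>M)"
    proof (rule integral_mono_AE)
      show "AE \<omega> in M. min (v \<omega>) (real n) \<le> min (\<rho> * u \<omega>) (real n) + R \<omega>"
        using le by eventually_elim linarith
    qed (use int R in auto)
    finally show ?thesis using int R by simp
  qed
  then have trunc: "(\<integral>\<^sup>+\<omega>. ennreal (min (u \<omega>) (real n) - min (\<rho> * u \<omega>) (real n)) \<partial>M) \<le> ennreal (\<integral>\<omega>. R \<omega> \<partial>M)" for n
    using u_min int by (subst nn_integral_eq_integral) (auto intro!: ennreal_leI)
  \<comment> \<open>For fixed \<omega> both truncations become inactive once \<open>n\<close>
    exceeds \<open>u \<omega>\<close>, because \<open>\<rho> * u \<omega> \<le> u \<omega>\<close>.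
    Fatou's lemma then transfers the uniform bound to \<open>(1 - \<rho>) * u\<close>.\<close>
  have "(\<integral>\<^sup>+\<omega>. ennreal ((1 - \<rho>) * u \<omega>) \<partial>M) =
      (\<integral>\<^sup>+\<omega>. liminf (\<lambda>n. ennreal (min (u \<omega>) (real n) - min (\<rho> * u \<omega>) (real n))) \<partial>M)"
  proof (intro nn_integral_cong lim_imp_Liminf[symmetric] tendsto_eventually)
    fix \<omega>
    obtain N where N: "u \<omega> \<le> real N" using real_arch_simple by blast
    show "\<forall>\<^sub>F n in sequentially. ennreal (min (u \<omega>) (real n) - min (\<rho> * u \<omega>) (real n)) = ennreal ((1 - \<rho>) * u \<omega>)"
      using eventually_ge_at_top[of N]
    proof eventually_elim
      case (elim n)
      then have "u \<omega> \<le> real n" using N by simp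
      moreover have "\<rho> * u \<omega> \<le> u \<omega>" using u0 \<rho> by (simp add: mult_left_le_one_le)
      ultimately show ?case by (simp add: min_absorb1 algebra_simps)
    qed
  qed simp
  also have "\<dots> \<le> liminf (\<lambda>n. \<integral>\<^sup>+\<omega>. ennreal (min (u \<omega>) (real n) - min (\<rho> * u \<omega>) (real n)) \<partial>M)"
    by (intro nn_integral_liminf) auto
  also have "\<dots> \<le> liminf (\<lambda>n::nat. ennreal (\<integral>\<omega>. R \<omega> \<partial>M))"
    by (intro Liminf_mono always_eventually allI trunc)
  also have "\<dots> < \<infinity>" by (simp add: Liminf_const)
  finally have "integrable M (\<lambda>\<omega>. (1 - \<rho>) * u \<omega>)"
    using u0 \<rho> by (intro integrableI_nonneg) auto
  then show ?thesis using \<rho> by simp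
qed

text \<open>Removing the noise leaves \<open>z = y - w\<close>, which is differentiable with
  derivative \<open>f (y t)\<close>, so its squared norm obeys an ordinary differential inequality.
  Dissipativity is applied to the pair \<open>z t\<close> and 0, the Lipschitz bound pays for
  replacing \<open>f (y t)\<close> by \<open>f (z t)\<close>, and Gronwall contracts by
  \<open>exp (- \<alpha>)\<close>. Restoring the noise at time 1 gives back half of that
  exponent.\<close>

lemma dissipative_path_bound:
  fixes f :: "'a::euclidean_space \<Rightarrow> 'a" and y w :: "real \<Rightarrow> 'a"
  assumes diss: "\<And>x x'. (f x - f x') \<bullet> (x - x') \<le> \<beta> - \<alpha> * (norm (x - x'))\<^sup>2"
    and lip: "\<And>x x'. norm (f x - f x') \<le> L * norm (x - x')"
    and pos: "0 < \<alpha>" "0 < \<beta>" "0 < L"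
    and y: "continuous_on {0..1} y" and w: "continuous_on {0..1} w"
    and eq: "\<And>t. t \<in> {0..1} \<Longrightarrow> y t = y 0 + integral {0..t} (\<lambda>s. f (y s)) + w t"
  shows "(norm (y 1))\<^sup>2 \<le> exp (- \<alpha> / 2) * (norm (y 0))\<^sup>2 +
     (exp (\<alpha> / 2) * integral {0..1} (\<lambda>t. 2 * \<beta> + 2 * (norm (f 0))\<^sup>2 / \<alpha> + 2 * L\<^sup>2 / \<alpha> * (norm (w t))\<^sup>2) +
      (1 + 1 / (exp (\<alpha> / 2) - 1)) * (norm (w 1))\<^sup>2)"
proof -
  define k where "k t = 2 * \<beta> + 2 * (norm (f 0))\<^sup>2 / \<alpha> + 2 * L\<^sup>2 / \<alpha> * (norm (w t))\<^sup>2" for t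
  define z where "z t = y 0 + integral {0..t} (\<lambda>s. f (y s))" for t
  have f: "continuous_on UNIV f"
    using pos lip by (intro lipschitz_on_continuous_on[of L] lipschitz_onI) (auto simp: dist_norm)
  have fy: "continuous_on {0..1} (\<lambda>s. f (y s))"
    by (rule continuous_on_compose2[OF f y]) auto
  have yz: "y t = z t + w t" if "t \<in> {0..1}" for t using eq[OF that] by (simp add: z_def)
  have young: "2 * a * c \<le> e * a\<^sup>2 + c\<^sup>2 / e" if "0 < e" for a c e :: real
  proof -
    have "0 \<le> (e * a - c)\<^sup>2 / e" using that by simp
    also have "\<dots> = e * a\<^sup>2 + c\<^sup>2 / e - 2 * a * c"
      using that by (simp add: field_simps power2_eq_square)
    finally show ?thesis by simp
  qed
  have z': "(z has_vector_derivative f (y t)) (at t within {0..1})" if "t \<in> {0..1}" for t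
    unfolding z_def using integral_has_vector_derivative[OF fy that]
    by (auto intro!: derivative_eq_intros)
  have "(norm (z 1))\<^sup>2 \<le> exp (- \<alpha> * 1) * (norm (z 0))\<^sup>2 + integral {0..1} k"
  proof (rule dissipative_gronwall[where u'="\<lambda>t. 2 * (f (y t) \<bullet> z t)"])
    fix t :: real assume t: "t \<in> {0..1}"
    have "((\<lambda>t. z t \<bullet> z t) has_vector_derivative (z t \<bullet> f (y t) + f (y t) \<bullet> z t)) (at t within {0..1})"
      using bounded_bilinear.has_vector_derivative[OF bounded_bilinear_inner z'[OF t] z'[OF t]] .
    then show "((\<lambda>t. (norm (z t))\<^sup>2) has_real_derivative 2 * (f (y t) \<bullet> z t)) (at t within {0..1})"
      by (simp add: power2_norm_eq_inner has_real_derivative_iff_has_vector_derivative inner_commute)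
    have "f (y t) \<bullet> z t = (f (y t) - f (z t)) \<bullet> z t + (f (z t) - f 0) \<bullet> (z t - 0) + f 0 \<bullet> z t"
      by (simp add: inner_diff_left)
    also have "\<dots> \<le> L * norm (w t) * norm (z t) + (\<beta> - \<alpha> * (norm (z t))\<^sup>2) + norm (f 0) * norm (z t)"
    proof (intro add_mono)
      have "(f (y t) - f (z t)) \<bullet> z t \<le> norm (f (y t) - f (z t)) * norm (z t)" by (rule norm_cauchy_schwarz)
      also have "\<dots> \<le> L * norm (w t) * norm (z t)"
        using lip[of "y t" "z t"] yz[OF t] by (intro mult_right_mono) auto
      finally show "(f (y t) - f (z t)) \<bullet> z t \<le> L * norm (w t) * norm (z t)" .
      show "(f (z t) - f 0) \<bullet> (z t - 0) \<le> \<beta> - \<alpha> * (norm (z t))\<^sup>2" using diss[of "z t" 0] by simp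
    qed (rule norm_cauchy_schwarz)
    finally have "2 * (f (y t) \<bullet> z t) \<le> 2 * norm (z t) * (L * norm (w t)) + 2 * norm (z t) * norm (f 0)
        + 2 * \<beta> - 2 * (\<alpha> * (norm (z t))\<^sup>2)" by (simp add: algebra_simps)
    \<comment> \<open>Young's inequality with weight \<open>\<alpha> / 2\<close>: each cross term
      uses up \<open>\<alpha> / 2\<close> of the coefficient \<open>2 * \<alpha>\<close> of the
      squared norm of \<open>z t\<close>, so that \<open>\<alpha>\<close> remains.\<close>
    moreover have "2 * norm (z t) * (L * norm (w t)) \<le> \<alpha> * (norm (z t))\<^sup>2 / 2 + 2 * L\<^sup>2 / \<alpha> * (norm (w t))\<^sup>2"
      "2 * norm (z t) * norm (f 0) \<le> \<alpha> * (norm (z t))\<^sup>2 / 2 + 2 * (norm (f 0))\<^sup>2 / \<alpha>"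
      using young[of "\<alpha> / 2" "norm (z t)" "L * norm (w t)"] young[of "\<alpha> / 2" "norm (z t)" "norm (f 0)"] pos
      by (simp_all add: power_mult_distrib mult_ac)
    ultimately show "2 * (f (y t) \<bullet> z t) \<le> - \<alpha> * (norm (z t))\<^sup>2 + k t"
      by (simp add: k_def)
  qed (use pos w in \<open>auto simp: k_def[abs_def] intro!: continuous_intros\<close>)
  then have z1: "exp (\<alpha> / 2) * (norm (z 1))\<^sup>2 \<le> exp (\<alpha> / 2) * (exp (- \<alpha>) * (norm (y 0))\<^sup>2 + integral {0..1} k)"
    by (intro mult_left_mono) (auto simp: z_def)
  have e: "0 < exp (\<alpha> / 2) - 1" using pos by simp
  have "(norm (y 1))\<^sup>2 \<le> (norm (z 1) + norm (w 1))\<^sup>2"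
    using yz[of 1] by (intro power_mono) (auto intro: norm_triangle_ineq)
  also have "\<dots> = (norm (z 1))\<^sup>2 + (norm (w 1))\<^sup>2 + 2 * norm (z 1) * norm (w 1)" by (simp add: power2_sum)
  \<comment> \<open>Young's inequality with weight \<open>exp (\<alpha> / 2) - 1\<close>, chosen so
    that the total coefficient of the \<open>z\<close> term is
    \<open>exp (\<alpha> / 2)\<close>.\<close>
  also have "\<dots> \<le> exp (\<alpha> / 2) * (norm (z 1))\<^sup>2 + (1 + 1 / (exp (\<alpha> / 2) - 1)) * (norm (w 1))\<^sup>2"
    using young[OF e, of "norm (z 1)" "norm (w 1)"] by (simp add: algebra_simps)
  also note z1
  also have "exp (\<alpha> / 2) * (exp (- \<alpha>) * (norm (y 0))\<^sup>2 + integral {0..1} k) =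
      exp (- \<alpha> / 2) * (norm (y 0))\<^sup>2 + exp (\<alpha> / 2) * integral {0..1} k"
    by (simp add: distrib_left mult.assoc[symmetric] exp_add[symmetric])
  finally show ?thesis by (simp only: k_def[abs_def] add.assoc)
qed

section \<open>Stationary solutions: the laws of the noise and of the marginals\<close>

definition isotropic_gaussian :: "real \<Rightarrow> (real^'d) measure" where
  "isotropic_gaussian t =
    distr (\<Pi>\<^sub>M i\<in>UNIV. density lborel (normal_density 0 (sqrt t))) borel (\<lambda>x. \<chi> i. x i)"

lemma measurable_vec_lambda [measurable]:
  "(\<lambda>x. (\<chi> i. x i) :: real^'d) \<in> (\<Pi>\<^sub>M (i::'d::finite)\<in>UNIV. borel) \<rightarrow>\<^sub>M borel"
proof (rule borel_measurable_euclidean_space[THEN iffD2], intro ballI)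
  fix b :: "real^'d" assume "b \<in> Basis"
  then obtain i where "b = axis i 1" by (auto simp: Basis_vec_def)
  then have "(\<lambda>x. (\<chi> i. x i) \<bullet> b) = (\<lambda>x. x i)" by (simp add: inner_axis fun_eq_iff)
  then show "(\<lambda>x. (\<chi> i. x i) \<bullet> b) \<in> borel_measurable (\<Pi>\<^sub>M (i::'d)\<in>UNIV. borel)" by simp
qed

lemma Int_stable_vimage: "Int_stable {X -` A \<inter> S | A. A \<in> sets N}"
proof (rule Int_stableI)
  fix a b assume "a \<in> {X -` A \<inter> S | A. A \<in> sets N}" "b \<in> {X -` A \<inter> S | A. A \<in> sets N}"
  then obtain A A' where "A \<in> sets N" "A' \<in> sets N" "a = X -` A \<inter> S" "b = X -` A' \<inter> S" by blast
  then have "A \<inter> A' \<in> sets N" "a \<inter> b = X -` (A \<inter> A') \<inter> S" by auto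
  then show "a \<inter> b \<in> {X -` A \<inter> S | A. A \<in> sets N}" by blast
qed

locale stationary_sde = prob_space P
  for P :: "'w measure" and B :: "real \<Rightarrow> 'w \<Rightarrow> real^'d" and \<sigma> :: "real^'d^'d"
    and f :: "real^'d \<Rightarrow> real^'d" and Y :: "real \<Rightarrow> 'w \<Rightarrow> real^'d" +
  fixes L :: real
  assumes solution: "stationary_solution P B \<sigma> f Y"
    and L: "0 < L" and lipschitz: "\<And>x y. norm (f x - f y) \<le> L * norm (x - y)"
begin

lemma brownian: "brownian_motion P B"
  using solution by (simp add: stationary_solution_def sde_solution_def)

lemma B_measurable [measurable]: "0 \<le> t \<Longrightarrow> B t \<in> borel_measurable P"
  using brownian by (simp add: brownian_motion_def)

lemma Y_measurable [measurable]: "0 \<le> t \<Longrightarrow> Y t \<in> borel_measurable P"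
  using solution by (simp add: stationary_solution_def sde_solution_def)

lemma B_paths: "AE \<omega> in P. B 0 \<omega> = 0 \<and> continuous_on {0..} (\<lambda>t. B t \<omega>)"
  using brownian by (simp add: brownian_motion_def)

lemma Y_paths: "AE \<omega> in P. continuous_on {0..} (\<lambda>t. Y t \<omega>) \<and>
    (\<forall>t\<ge>0. Y t \<omega> = Y 0 \<omega> + integral {0..t} (\<lambda>s. f (Y s \<omega>)) + \<sigma> *v B t \<omega>)"
  using solution by (simp add: stationary_solution_def sde_solution_def)

lemma f_continuous: "continuous_on UNIV f"
  using L lipschitz by (intro lipschitz_on_continuous_on[of L] lipschitz_onI) (auto simp: dist_norm)

lemma f_measurable [measurable]: "f \<in> borel_measurable borel"
  by (rule borel_measurable_continuous_onI[OF f_continuous])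

lemma marginal:
  assumes "0 \<le> t"
  shows "distr P borel (Y t) = distr P borel (Y 0)"
proof -
  \<comment> \<open>Evaluating the shifted path at time 0 recovers the marginal at time
    \<open>h\<close>; stationarity equates the path laws for \<open>h = t\<close> and
    \<open>h = 0\<close>.\<close>
  have "distr (distr P (\<Pi>\<^sub>M t\<in>{0..}. borel) (\<lambda>\<omega>. \<lambda>s\<in>{0..}. Y (s + h) \<omega>)) borel (\<lambda>x. x 0) = distr P borel (Y h)"
    if "0 \<le> h" for h :: real
    using that by (subst distr_distr) (auto simp: comp_def intro!: measurable_restrict)
  from this[OF assms] this[of 0] show ?thesis
    using solution assms by (simp add: stationary_solution_def stationary_process_def)
qed

lemma nn_integral_Y:
  assumes "0 \<le> t" and [measurable]: "g \<in> borel_measurable borel"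
  shows "(\<integral>\<^sup>+\<omega>. g (Y t \<omega>) \<partial>P) = (\<integral>\<^sup>+\<omega>. g (Y 0 \<omega>) \<partial>P)"
  using assms marginal[of t] nn_integral_distr[of "Y t" P borel g] nn_integral_distr[of "Y 0" P borel g]
  by simp

lemma expectation_Y:
  fixes g :: "real^'d \<Rightarrow> real"
  assumes "0 \<le> t" and [measurable]: "g \<in> borel_measurable borel"
  shows "expectation (\<lambda>\<omega>. g (Y t \<omega>)) = expectation (\<lambda>\<omega>. g (Y 0 \<omega>))"
  using assms marginal[of t] integral_distr[of "Y t" P borel g] integral_distr[of "Y 0" P borel g]
  by simp

lemma B_eq_increment: "AE \<omega> in P. B t \<omega> = B t \<omega> - B 0 \<omega>"
  using B_paths by eventually_elim simp

lemma increment_distributed: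
  assumes "0 < t"
  shows "distributed P lborel (\<lambda>\<omega>. (B t \<omega> - B 0 \<omega>) $ i) (normal_density 0 (sqrt t))"
proof -
  have "\<forall>s\<ge>0. \<forall>t>s. \<forall>i. distributed P lborel (\<lambda>\<omega>. (B t \<omega> - B s \<omega>) $ i) (normal_density 0 (sqrt (t - s)))"
    using brownian unfolding brownian_motion_def by blast
  from this[rule_format, of 0 t i] assms show ?thesis by simp
qed

text \<open>The hypotheses on \<open>B\<close> concern increments, and \<open>B 0 = 0\<close> holds
  almost surely, so \<open>B t\<close> shares the law of \<open>B t - B 0\<close>. Independence of
  the coordinates makes this a product of normal laws. The result refers to neither \<open>P\<close>
  nor \<open>B\<close>, which makes solutions on different probability spaces comparable.\<close>

lemma distr_B:
  assumes t: "0 < t"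
  shows "distr P borel (B t) = isotropic_gaussian t"
proof -
  have [measurable]: "B t \<in> borel_measurable P" "B 0 \<in> borel_measurable P" using t by auto
  define X where "X i \<omega> = (B t \<omega> - B 0 \<omega>) $ i" for i \<omega>
  have [measurable]: "X i \<in> borel_measurable P" for i
    unfolding X_def by (intro borel_measurable_nth[THEN measurable_compose[rotated]]) auto
  have "indep_vars (\<lambda>i. borel) X UNIV"
    using brownian t unfolding brownian_motion_def X_def[abs_def] by auto
  then have "distr P (\<Pi>\<^sub>M i\<in>UNIV. borel) (\<lambda>\<omega>. \<lambda>i\<in>UNIV. X i \<omega>) = (\<Pi>\<^sub>M i\<in>UNIV. distr P borel (X i))"
    by (subst (asm) indep_vars_iff_distr_eq_PiM) auto
  also have "\<dots> = (\<Pi>\<^sub>M i\<in>UNIV. density lborel (normal_density 0 (sqrt t)))"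
  proof (rule PiM_cong)
    fix i
    have "distr P borel (X i) = distr P lborel (X i)" by (rule distr_cong) auto
    then show "distr P borel (X i) = density lborel (normal_density 0 (sqrt t))"
      using increment_distributed[OF t, of i] by (simp add: distributed_def X_def[abs_def])
  qed simp
  finally have joint: "distr P (\<Pi>\<^sub>M i\<in>UNIV. borel) (\<lambda>\<omega>. \<lambda>i\<in>UNIV. X i \<omega>) =
    (\<Pi>\<^sub>M i\<in>UNIV. density lborel (normal_density 0 (sqrt t)))" .
  have "distr P borel (B t) = distr P borel (\<lambda>\<omega>. B t \<omega> - B 0 \<omega>)"
    using B_eq_increment[of t] by (intro distr_cong_AE) auto
  also have "(\<lambda>\<omega>. B t \<omega> - B 0 \<omega>) = (\<lambda>\<omega>. \<chi> i. X i \<omega>)"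
    unfolding X_def by (simp only: vec_lambda_eta)
  also have "distr P borel (\<lambda>\<omega>. \<chi> i. X i \<omega>) = distr (distr P (\<Pi>\<^sub>M i\<in>UNIV. borel) (\<lambda>\<omega>. \<lambda>i\<in>UNIV. X i \<omega>)) borel (\<lambda>x. \<chi> i. x i)"
    by (subst distr_distr[OF measurable_vec_lambda measurable_restrict]) (simp_all add: comp_def restrict_def)
  finally show ?thesis unfolding joint isotropic_gaussian_def .
qed

lemma B_second_moment:
  assumes t: "0 \<le> t"
  shows "(\<integral>\<^sup>+\<omega>. ennreal ((norm (B t \<omega>))\<^sup>2) \<partial>P) \<le> ennreal (real CARD('d) * t)"
proof (cases "t = 0")
  case True
  \<comment> \<open>The hypothesis on increments concerns \<open>s < t\<close>, so the moment at
    time 0 has to come from \<open>B 0 = 0\<close>.\<close>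
  have "(\<integral>\<^sup>+\<omega>. ennreal ((norm (B t \<omega>))\<^sup>2) \<partial>P) = (\<integral>\<^sup>+\<omega>. 0 \<partial>P)"
    using B_paths True by (intro nn_integral_cong_AE) (auto elim!: eventually_mono)
  then show ?thesis by simp
next
  case False
  then have t: "0 < t" using t by simp
  define X where "X i \<omega> = (B t \<omega> - B 0 \<omega>) $ i" for i \<omega>
  have [measurable]: "B t \<in> borel_measurable P" "B 0 \<in> borel_measurable P" using t by auto
  have [measurable]: "X i \<in> borel_measurable P" for i
    unfolding X_def by (intro borel_measurable_nth[THEN measurable_compose[rotated]]) auto
  have X: "(\<integral>\<^sup>+\<omega>. ennreal ((X i \<omega>)\<^sup>2) \<partial>P) = ennreal t" for i
  proof -
    have "(\<integral>\<^sup>+\<omega>. ennreal ((X i \<omega>)\<^sup>2) \<partial>P) = (\<integral>\<^sup>+x. ennreal (normal_density 0 (sqrt t) x) * ennreal (x\<^sup>2) \<partial>lborel)"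
      using distributed_nn_integral[OF increment_distributed[OF t, of i], of "\<lambda>x. ennreal (x\<^sup>2)"]
      by (simp add: X_def)
    also have "\<dots> = (\<integral>\<^sup>+x. ennreal (normal_density 0 (sqrt t) x * x\<^sup>2) \<partial>lborel)"
      by (simp add: ennreal_mult normal_density_nonneg)
    also have "\<dots> = ennreal t"
    proof -
      have "has_bochner_integral lborel (\<lambda>x. normal_density 0 (sqrt t) x * x\<^sup>2) t"
        using normal_moment_even[of "sqrt t" 0 1] t by simp
      then show ?thesis
        by (subst nn_integral_eq_integral) (auto simp: has_bochner_integral_iff normal_density_nonneg)
    qed
    finally show ?thesis .
  qed
  have "(\<integral>\<^sup>+\<omega>. ennreal ((norm (B t \<omega>))\<^sup>2) \<partial>P) = (\<integral>\<^sup>+\<omega>. (\<Sum>i\<in>UNIV. ennreal ((X i \<omega>)\<^sup>2)) \<partial>P)"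
  proof (rule nn_integral_cong_AE)
    show "AE \<omega> in P. ennreal ((norm (B t \<omega>))\<^sup>2) = (\<Sum>i\<in>UNIV. ennreal ((X i \<omega>)\<^sup>2))"
      using B_paths by eventually_elim (simp add: X_def norm_vec_def L2_set_def sum_nonneg)
  qed
  also have "\<dots> = (\<Sum>i\<in>(UNIV::'d set). ennreal t)" by (subst nn_integral_sum) (simp_all add: X)
  also have "\<dots> = ennreal (real CARD('d) * t)"
    using t by (simp add: ennreal_mult ennreal_of_nat_eq_real_of_nat)
  finally show ?thesis by simp
qed

text \<open>Independence is assumed between \<open>Y 0\<close> and the whole path of
  \<open>B\<close>, whose value types differ. Each event about \<open>B t\<close> alone is a
  cylinder event of the path, so independence descends to \<open>Y 0\<close> and \<open>B t\<close>,
  which share a value type, and there it amounts to a product law.\<close>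

lemma joint_distr:
  assumes t: "0 \<le> t"
  shows "distr P (borel \<Otimes>\<^sub>M borel) (\<lambda>\<omega>. (Y 0 \<omega>, B t \<omega>)) = distr P borel (Y 0) \<Otimes>\<^sub>M distr P borel (B t)"
proof -
  let ?Z = "\<lambda>\<omega>. \<lambda>t\<in>{0..}. B t \<omega>"
  let ?N = "(\<Pi>\<^sub>M t\<in>{0..}. borel) :: (real \<Rightarrow> real^'d) measure"
  have ind: "indep_set {Y 0 -` A \<inter> space P | A. A \<in> sets borel} {?Z -` A \<inter> space P | A. A \<in> sets ?N}"
    using solution by (simp add: stationary_solution_def sde_solution_def independent_rvs_def)
  have cyl: "B t -` A \<inter> space P \<in> {?Z -` A \<inter> space P | A. A \<in> sets ?N}" if "A \<in> sets borel" for A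
  proof -
    have "(\<lambda>x. x t) \<in> ?N \<rightarrow>\<^sub>M borel" using t by (intro measurable_component_singleton) auto
    from measurable_sets[OF this that]
    have "(\<lambda>x. x t) -` A \<inter> space ?N \<in> sets ?N" .
    moreover have "B t -` A \<inter> space P = ?Z -` ((\<lambda>x. x t) -` A \<inter> space ?N) \<inter> space P"
      using t by (auto simp: space_PiM)
    ultimately show ?thesis by blast
  qed
  have "indep_set {Y 0 -` A \<inter> space P | A. A \<in> sets borel} {B t -` A \<inter> space P | A. A \<in> sets borel}"
    unfolding indep_sets2_eq
  proof (intro conjI ballI)
    fix a b assume "a \<in> {Y 0 -` A \<inter> space P | A. A \<in> sets borel}"
      "b \<in> {B t -` A \<inter> space P | A. A \<in> sets borel}"
    then show "prob (a \<inter> b) = prob a * prob b" using cyl by (intro indep_setD[OF ind]) auto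
  qed (use t in auto)
  then have "indep_set (sigma_sets (space P) {Y 0 -` A \<inter> space P | A. A \<in> sets borel})
      (sigma_sets (space P) {B t -` A \<inter> space P | A. A \<in> sets borel})"
    by (rule indep_set_sigma_sets) (rule Int_stable_vimage)+
  then have "indep_var borel (Y 0) borel (B t)"
    using t by (simp add: indep_var_eq)
  then show ?thesis by (simp add: indep_var_distribution_eq)
qed

text \<open>Once the law of \<open>Y 0\<close> is given, the right-hand side no longer involves the
  drift. It serves as the common reference term for two equations with the same stationary
  marginal.\<close>

lemma noise_perturbation:
  fixes \<phi> :: "real^'d \<Rightarrow> real"
  assumes t: "0 < t" and [measurable]: "\<phi> \<in> borel_measurable borel"
  shows "expectation (\<lambda>\<omega>. \<phi> (Y 0 \<omega> + \<sigma> *v B t \<omega>)) =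
    (\<integral>(y, z). \<phi> (y + \<sigma> *v z) \<partial>(distr P borel (Y 0) \<Otimes>\<^sub>M isotropic_gaussian t))"
proof -
  have [measurable]: "(\<lambda>z. \<sigma> *v z) \<in> borel_measurable borel"
    by (intro borel_measurable_continuous_onI linear_continuous_on matrix_vector_mul_bounded_linear)
  have pair: "(\<lambda>\<omega>. (Y 0 \<omega>, B t \<omega>)) \<in> P \<rightarrow>\<^sub>M borel \<Otimes>\<^sub>M borel"
    using t by (intro measurable_Pair) auto
  have int: "(\<lambda>(y, z). \<phi> (y + \<sigma> *v z)) \<in> borel_measurable (borel \<Otimes>\<^sub>M borel)" by measurable
  have "(\<integral>(y, z). \<phi> (y + \<sigma> *v z) \<partial>distr P (borel \<Otimes>\<^sub>M borel) (\<lambda>\<omega>. (Y 0 \<omega>, B t \<omega>))) =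
      expectation (\<lambda>\<omega>. \<phi> (Y 0 \<omega> + \<sigma> *v B t \<omega>))"
    using integral_distr[OF pair int] by simp
  then show ?thesis using t by (simp add: joint_distr distr_B)
qed

text \<open>By stationarity \<open>norm (Y 0)\<close> and \<open>norm (Y 1)\<close> have the same
  law, while the pathwise bound with noise \<open>\<sigma> *v B t\<close> contracts the squared norm
  by \<open>exp (- \<alpha> / 2)\<close>. The remainder is integrable because the second moments of
  \<open>B t\<close> are bounded on the unit interval.\<close>

lemma second_moment:
  assumes diss: "\<And>x y. (f x - f y) \<bullet> (x - y) \<le> \<beta> - \<alpha> * (norm (x - y))\<^sup>2"
    and pos: "0 < \<alpha>" "0 < \<beta>"
  shows "integrable P (\<lambda>\<omega>. (norm (Y 0 \<omega>))\<^sup>2)"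
proof -
  obtain K where K: "0 < K" "\<And>x. norm (\<sigma> *v x) \<le> norm x * K"
    using bounded_linear.pos_bounded[OF matrix_vector_mul_bounded_linear[of \<sigma>]] by blast
  have [measurable]: "(\<lambda>z. \<sigma> *v z) \<in> borel_measurable borel"
    by (intro borel_measurable_continuous_onI linear_continuous_on matrix_vector_mul_bounded_linear)
  have cont_mult: "continuous_on S (\<lambda>t. \<sigma> *v g t)" if "continuous_on S g" for S and g :: "real \<Rightarrow> real^'d"
    using matrix_vector_mul_bounded_linear that by (rule bounded_linear.continuous_on)
  define w where "w t \<omega> = (norm (\<sigma> *v B t \<omega>))\<^sup>2" for t \<omega>
  have [measurable]: "w t \<in> borel_measurable P" if "0 \<le> t" for t
    unfolding w_def using that by measurable
  have w0: "0 \<le> w t \<omega>" for t \<omega> by (simp add: w_def)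
  have w_le: "(\<integral>\<^sup>+\<omega>. ennreal (w t \<omega>) \<partial>P) \<le> ennreal (K\<^sup>2 * CARD('d))" if t: "t \<in> {0..1}" for t
  proof -
    have "(\<integral>\<^sup>+\<omega>. ennreal (w t \<omega>) \<partial>P) \<le> (\<integral>\<^sup>+\<omega>. ennreal (K\<^sup>2) * ennreal ((norm (B t \<omega>))\<^sup>2) \<partial>P)"
    proof (rule nn_integral_mono)
      fix \<omega>
      have "w t \<omega> \<le> (norm (B t \<omega>) * K)\<^sup>2" unfolding w_def by (intro power_mono K) auto
      then show "ennreal (w t \<omega>) \<le> ennreal (K\<^sup>2) * ennreal ((norm (B t \<omega>))\<^sup>2)"
        by (simp add: ennreal_mult[symmetric] power_mult_distrib mult.commute)
    qed
    also have "\<dots> = ennreal (K\<^sup>2) * (\<integral>\<^sup>+\<omega>. ennreal ((norm (B t \<omega>))\<^sup>2) \<partial>P)"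
      using t by (intro nn_integral_cmult) auto
    also have "\<dots> \<le> ennreal (K\<^sup>2) * ennreal (real CARD('d) * t)"
      using t by (intro mult_left_mono B_second_moment) auto
    also have "\<dots> \<le> ennreal (K\<^sup>2) * ennreal (real CARD('d))"
      using t by (intro mult_left_mono ennreal_leI) auto
    finally show ?thesis by (simp add: ennreal_mult)
  qed
  obtain A where A [measurable]: "A \<in> borel_measurable P"
    "AE \<omega> in P. A \<omega> = integral {0..1} (\<lambda>t. w t \<omega>)"
    "(\<integral>\<^sup>+\<omega>. ennreal (A \<omega>) \<partial>P) \<le> ennreal 1 * ennreal (K\<^sup>2 * CARD('d))"
  proof (rule time_integral_nn_integral_le)
    show "AE \<omega> in P. continuous_on {0..1} (\<lambda>t. w t \<omega>)"
      using B_paths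
    proof eventually_elim
      case (elim \<omega>)
      then have "continuous_on {0..1} (\<lambda>t. B t \<omega>)" by (auto intro: continuous_on_subset)
      then show ?case unfolding w_def by (intro continuous_intros cont_mult)
    qed
  qed (use w0 w_le in auto)
  have A0: "AE \<omega> in P. 0 \<le> A \<omega>"
    using A(2)
  proof eventually_elim
    case (elim \<omega>)
    \<comment> \<open>The integral of a non-integrable function is 0 by convention, so either case
      gives a nonnegative value.\<close>
    then show ?case
      by (cases "(\<lambda>t. w t \<omega>) integrable_on {0..1}")
        (auto simp: w0 not_integrable_integral intro: Henstock_Kurzweil_Integration.integral_nonneg)
  qed
  have A_int: "integrable P A"
    using A(3) A0 by (intro integrableI_nonneg) (auto elim: le_less_trans)
  have w_int: "integrable P (w 1)"
    using w_le[of 1] w0 by (intro integrableI_nonneg) (auto elim: le_less_trans)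
  define c where "c = 2 * \<beta> + 2 * (norm (f 0))\<^sup>2 / \<alpha>"
  define c' where "c' = 2 * L\<^sup>2 / \<alpha>"
  \<comment> \<open>\<open>A\<close> stands in for the time integral of \<open>w\<close>, so that
    \<open>R\<close> is measurable.\<close>
  define R where "R \<omega> = exp (\<alpha> / 2) * (c + c' * A \<omega>) + (1 + 1 / (exp (\<alpha> / 2) - 1)) * w 1 \<omega>" for \<omega>
  have cc: "0 \<le> c" "0 \<le> c'" using pos by (auto simp: c_def c'_def)
  have ex: "1 < exp (\<alpha> / 2)" using pos by simp
  show ?thesis
  proof (rule integrable_if_contracting_in_law[where \<rho>="exp (- \<alpha> / 2)" and R=R and v="\<lambda>\<omega>. (norm (Y 1 \<omega>))\<^sup>2"])
    show "integrable P R" unfolding R_def using A_int w_int by auto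
    have "distr P borel (\<lambda>\<omega>. (norm (Y t \<omega>))\<^sup>2) = distr (distr P borel (Y t)) borel (\<lambda>x. (norm x)\<^sup>2)"
      if "0 \<le> t" for t using that by (subst distr_distr) (auto simp: comp_def)
    then show "distr P borel (\<lambda>\<omega>. (norm (Y 0 \<omega>))\<^sup>2) = distr P borel (\<lambda>\<omega>. (norm (Y 1 \<omega>))\<^sup>2)"
      using marginal[of 1] by simp
    show "AE \<omega> in P. 0 \<le> R \<omega> \<and> (norm (Y 1 \<omega>))\<^sup>2 \<le> exp (- \<alpha> / 2) * (norm (Y 0 \<omega>))\<^sup>2 + R \<omega>"
      using A(2) A0 B_paths Y_paths
    proof eventually_elim
      case (elim \<omega>)
      have Bc: "continuous_on {0..1} (\<lambda>t. B t \<omega>)" and Yc: "continuous_on {0..1} (\<lambda>t. Y t \<omega>)"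
        using elim by (auto intro: continuous_on_subset)
      have "continuous_on {0..1} (\<lambda>t. w t \<omega>)"
        unfolding w_def by (intro continuous_intros cont_mult Bc)
      then have "(\<lambda>t. c' * w t \<omega>) integrable_on {0..1}"
        by (intro integrable_continuous_interval continuous_intros)
      then have "integral {0..1} (\<lambda>t. c + c' * w t \<omega>) = c + c' * A \<omega>"
        using elim(1) by (subst integral_add) auto
      moreover have "(norm (Y 1 \<omega>))\<^sup>2 \<le> exp (- \<alpha> / 2) * (norm (Y 0 \<omega>))\<^sup>2 +
        (exp (\<alpha> / 2) * integral {0..1} (\<lambda>t. 2 * \<beta> + 2 * (norm (f 0))\<^sup>2 / \<alpha> + 2 * L\<^sup>2 / \<alpha> * (norm (\<sigma> *v B t \<omega>))\<^sup>2) +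
         (1 + 1 / (exp (\<alpha> / 2) - 1)) * (norm (\<sigma> *v B 1 \<omega>))\<^sup>2)"
        by (rule dissipative_path_bound[OF diss lipschitz pos L Yc cont_mult[OF Bc]])
          (use elim(4) in \<open>meson atLeastAtMost_iff\<close>)
      moreover have "0 \<le> R \<omega>"
        unfolding R_def using elim(2) cc ex w0 by (intro add_nonneg_nonneg mult_nonneg_nonneg) auto
      ultimately show ?case by (simp add: R_def c_def c'_def w_def)
    qed
  qed (use pos in auto)
qed

end

section \<open>Small-time limit of the mean of a test function\<close>

lemma GDERIV_continuous_on:
  assumes "\<And>x. GDERIV f x :> g x"
  shows "continuous_on S f"
  by (rule has_derivative_continuous_on[OF has_derivative_at_withinI[OF assms[unfolded gderiv_def]]])

context stationary_sde
begin

text \<open>The state \<open>Y t\<close> and the driftless \<open>Y 0 + \<sigma> *v B t\<close>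
  differ by the time integral of the drift, which is of order \<open>t\<close> on almost every path,
  so the difference quotient of \<open>\<phi>\<close> between them converges pathwise. Stationarity
  puts \<open>Y 0\<close> for \<open>Y t\<close> in the first mean. The quotient is at most
  \<open>K\<close> times a time average of \<open>norm (f (Y s))\<close>; by stationarity the mean
  of this average is at most that of \<open>norm (f (Y 0))\<close>, as
  \<open>dominated_convergence_varying_bound\<close> requires.\<close>

lemma generator_limit:
  fixes \<phi> :: "real^'d \<Rightarrow> real"
  assumes \<phi>: "\<And>x. GDERIV \<phi> x :> g x" and g: "continuous_on UNIV g"
    and g_le: "\<And>x. norm (g x) \<le> K" and \<phi>_le: "\<And>x. \<bar>\<phi> x\<bar> \<le> K'"
    and drift: "integrable P (\<lambda>\<omega>. norm (f (Y 0 \<omega>)))"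
  shows "(\<lambda>n. real (Suc n) * (expectation (\<lambda>\<omega>. \<phi> (Y 0 \<omega>)) -
      expectation (\<lambda>\<omega>. \<phi> (Y 0 \<omega> + \<sigma> *v B (1 / real (Suc n)) \<omega>))))
    \<longlonglongrightarrow> expectation (\<lambda>\<omega>. g (Y 0 \<omega>) \<bullet> f (Y 0 \<omega>))"
proof -
  have K: "0 \<le> K" using g_le[of 0] norm_ge_zero order_trans by blast
  have "continuous_on UNIV \<phi>"
    using \<phi> by (rule GDERIV_continuous_on)
  then have [measurable]: "\<phi> \<in> borel_measurable borel" by (rule borel_measurable_continuous_onI)
  have [measurable]: "g \<in> borel_measurable borel" using g by (rule borel_measurable_continuous_onI)
  have [measurable]: "(\<lambda>z. \<sigma> *v z) \<in> borel_measurable borel"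
    by (intro borel_measurable_continuous_onI linear_continuous_on matrix_vector_mul_bounded_linear)
  define \<tau> where "\<tau> n = 1 / real (Suc n)" for n
  have \<tau>: "0 < \<tau> n" "0 \<le> \<tau> n" "real (Suc n) * \<tau> n = 1" for n by (simp_all add: \<tau>_def)
  have \<tau>_lim: "\<tau> \<longlonglongrightarrow> 0" unfolding \<tau>_def[abs_def] by (rule LIMSEQ_Suc[OF lim_1_over_n])
  have [measurable]: "B (\<tau> n) \<in> borel_measurable P" "Y (\<tau> n) \<in> borel_measurable P" for n
    using \<tau> by auto
  define X where "X n \<omega> = Y 0 \<omega> + \<sigma> *v B (\<tau> n) \<omega>" for n \<omega>
  have [measurable]: "X n \<in> borel_measurable P" for n unfolding X_def[abs_def] by measurable
  have f_cont: "continuous_on {0..} (\<lambda>s. f (Y s \<omega>))" if "continuous_on {0..} (\<lambda>s. Y s \<omega>)" for \<omega>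
    by (rule continuous_on_compose2[OF f_continuous that]) auto
  have f_int: "(\<lambda>s. f (Y s \<omega>)) integrable_on {0..t}" "(\<lambda>s. norm (f (Y s \<omega>))) integrable_on {0..t}"
    if "continuous_on {0..} (\<lambda>s. Y s \<omega>)" for t \<omega>
    using f_cont[OF that]
    by (auto intro!: integrable_continuous_interval continuous_intros intro: continuous_on_subset)
  have "\<forall>n. \<exists>A. A \<in> borel_measurable P \<and> (AE \<omega> in P. A \<omega> = integral {0..\<tau> n} (\<lambda>t. norm (f (Y t \<omega>)))) \<and>
      (\<integral>\<^sup>+\<omega>. ennreal (A \<omega>) \<partial>P) \<le> ennreal (\<tau> n) * (\<integral>\<^sup>+\<omega>. ennreal (norm (f (Y 0 \<omega>))) \<partial>P)"
  proof
    fix n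
    show "\<exists>A. A \<in> borel_measurable P \<and> (AE \<omega> in P. A \<omega> = integral {0..\<tau> n} (\<lambda>t. norm (f (Y t \<omega>)))) \<and>
      (\<integral>\<^sup>+\<omega>. ennreal (A \<omega>) \<partial>P) \<le> ennreal (\<tau> n) * (\<integral>\<^sup>+\<omega>. ennreal (norm (f (Y 0 \<omega>))) \<partial>P)"
  proof (rule time_integral_nn_integral_le[where T="\<tau> n" and M=P and X="\<lambda>t \<omega>. norm (f (Y t \<omega>))"
        and c="\<integral>\<^sup>+\<omega>. ennreal (norm (f (Y 0 \<omega>))) \<partial>P"])
    show "AE \<omega> in P. continuous_on {0..\<tau> n} (\<lambda>t. norm (f (Y t \<omega>)))"
      using Y_paths
    proof eventually_elim
      case (elim \<omega>)
      then have "continuous_on {0..\<tau> n} (\<lambda>t. f (Y t \<omega>))"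
        by (intro continuous_on_subset[OF f_cont]) auto
      then show ?case by (rule continuous_on_norm)
    qed
    show "(\<integral>\<^sup>+\<omega>. ennreal (norm (f (Y t \<omega>))) \<partial>P) \<le> (\<integral>\<^sup>+\<omega>. ennreal (norm (f (Y 0 \<omega>))) \<partial>P)"
      if "t \<in> {0..\<tau> n}" for t
      using that nn_integral_Y[of t "\<lambda>x. ennreal (norm (f x))"] by simp
    qed (use \<tau> in auto)
  qed
  from choice[OF this] obtain A where A [measurable]: "\<And>n. A n \<in> borel_measurable P"
    and A_eq: "\<And>n. AE \<omega> in P. A n \<omega> = integral {0..\<tau> n} (\<lambda>t. norm (f (Y t \<omega>)))"
    and A_le: "\<And>n. (\<integral>\<^sup>+\<omega>. ennreal (A n \<omega>) \<partial>P) \<le> ennreal (\<tau> n) * (\<integral>\<^sup>+\<omega>. ennreal (norm (f (Y 0 \<omega>))) \<partial>P)"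
    by blast
  \<comment> \<open>The pathwise limit runs over all \<open>n\<close>, so one null set has to serve
    all of them.\<close>
  have A_eq': "AE \<omega> in P. \<forall>n. A n \<omega> = integral {0..\<tau> n} (\<lambda>t. norm (f (Y t \<omega>)))"
    using A_eq by (simp add: AE_all_countable)
  have "(\<lambda>n. \<integral>\<omega>. real (Suc n) * (\<phi> (Y (\<tau> n) \<omega>) - \<phi> (X n \<omega>)) \<partial>P) \<longlonglongrightarrow> expectation (\<lambda>\<omega>. g (Y 0 \<omega>) \<bullet> f (Y 0 \<omega>))"
  proof (rule dominated_convergence_varying_bound[where A="\<lambda>n \<omega>. K * (real (Suc n) * A n \<omega>)"
        and a="\<lambda>\<omega>. K * norm (f (Y 0 \<omega>))"])
    show "AE \<omega> in P. \<bar>real (Suc n) * (\<phi> (Y (\<tau> n) \<omega>) - \<phi> (X n \<omega>))\<bar> \<le> K * (real (Suc n) * A n \<omega>)" for n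
      using A_eq[of n] Y_paths
    proof eventually_elim
      case (elim \<omega>)
      define D where "D = integral {0..\<tau> n} (\<lambda>s. f (Y s \<omega>))"
      have Y_eq: "Y (\<tau> n) \<omega> = X n \<omega> + D" using elim(2)[THEN conjunct2, rule_format, OF \<tau>(2)[of n]] by (simp add: X_def D_def)
      obtain s where "\<phi> (X n \<omega> + D) - \<phi> (X n \<omega>) = g (X n \<omega> + s *\<^sub>R D) \<bullet> D"
        using gderiv_mean_value[of \<phi> g "X n \<omega>" D] \<phi> by metis
      then have "\<bar>\<phi> (X n \<omega> + D) - \<phi> (X n \<omega>)\<bar> \<le> norm (g (X n \<omega> + s *\<^sub>R D)) * norm D"
        by (simp add: Cauchy_Schwarz_ineq2)
      also have "\<dots> \<le> K * norm D" by (intro mult_right_mono g_le) auto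
      also have "norm D \<le> A n \<omega>"
        unfolding D_def using elim(1) f_int elim(2) by (metis (mono_tags, lifting) integral_norm_bound_integral order_refl)
      finally have "\<bar>\<phi> (Y (\<tau> n) \<omega>) - \<phi> (X n \<omega>)\<bar> \<le> K * A n \<omega>"
        using K by (simp add: Y_eq mult_left_mono)
      then have "real (Suc n) * \<bar>\<phi> (Y (\<tau> n) \<omega>) - \<phi> (X n \<omega>)\<bar> \<le> real (Suc n) * (K * A n \<omega>)"
        by (rule mult_left_mono) simp
      then show ?case by (simp add: abs_mult mult.left_commute)
    qed
    show "AE \<omega> in P. (\<lambda>n. K * (real (Suc n) * A n \<omega>)) \<longlonglongrightarrow> K * norm (f (Y 0 \<omega>))"
      using A_eq' Y_paths
    proof eventually_elim
      case (elim \<omega>)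
      have "continuous_on {0..} (\<lambda>t. norm (f (Y t \<omega>)))"
        using elim(2) by (intro continuous_on_norm f_cont) blast
      from tendsto_mult_left[OF average_tendsto[OF this], of K] show ?case
        using elim(1) by (simp add: \<tau>_def)
    qed
    show "AE \<omega> in P. (\<lambda>n. real (Suc n) * (\<phi> (Y (\<tau> n) \<omega>) - \<phi> (X n \<omega>))) \<longlonglongrightarrow> g (Y 0 \<omega>) \<bullet> f (Y 0 \<omega>)"
      using B_paths Y_paths
    proof eventually_elim
      case (elim \<omega>)
      define D where "D n = integral {0..\<tau> n} (\<lambda>s. f (Y s \<omega>))" for n
      have Y_eq: "Y (\<tau> n) \<omega> = X n \<omega> + D n" for n using elim(2)[THEN conjunct2, rule_format, OF \<tau>(2)[of n]] by (simp add: X_def D_def)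
      have quot: "(\<lambda>n. real (Suc n) *\<^sub>R D n) \<longlonglongrightarrow> f (Y 0 \<omega>)"
        using average_tendsto[OF f_cont[OF elim(2)[THEN conjunct1]]] by (simp add: D_def \<tau>_def)
      have "(\<lambda>n. \<tau> n *\<^sub>R (real (Suc n) *\<^sub>R D n)) \<longlonglongrightarrow> 0 *\<^sub>R f (Y 0 \<omega>)"
        by (intro tendsto_scaleR \<tau>_lim quot)
      moreover have "\<tau> n *\<^sub>R (real (Suc n) *\<^sub>R D n) = D n" for n
        using \<tau>(3)[of n] by (simp only: scaleR_scaleR mult.commute scaleR_one)
      ultimately have D0: "D \<longlonglongrightarrow> 0" by simp
      \<comment> \<open>Since \<open>B 0 \<omega> = 0\<close> on these paths, the moving base point
        \<open>X n \<omega>\<close> tends to \<open>Y 0 \<omega>\<close>.\<close>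
      have "(\<lambda>n. B (\<tau> n) \<omega>) \<longlonglongrightarrow> B 0 \<omega>"
        by (rule continuous_on_tendsto_compose[OF elim(1)[THEN conjunct2] \<tau>_lim]) (auto simp: \<tau>)
      then have "(\<lambda>n. \<sigma> *v B (\<tau> n) \<omega>) \<longlonglongrightarrow> \<sigma> *v B 0 \<omega>"
        by (rule bounded_linear.tendsto[OF matrix_vector_mul_bounded_linear])
      then have "(\<lambda>n. X n \<omega>) \<longlonglongrightarrow> Y 0 \<omega> + \<sigma> *v B 0 \<omega>"
        unfolding X_def by (intro tendsto_intros)
      then have "(\<lambda>n. X n \<omega>) \<longlonglongrightarrow> Y 0 \<omega>" using elim(1) by simp
      from tendsto_difference_quotient_along_sequence[OF \<phi> g this quot D0] show ?case
        by (simp add: Y_eq)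
    qed
    show "(\<integral>\<^sup>+\<omega>. ennreal (K * (real (Suc n) * A n \<omega>)) \<partial>P) \<le> (\<integral>\<^sup>+\<omega>. ennreal (K * norm (f (Y 0 \<omega>))) \<partial>P)" for n
    proof -
      have "(\<integral>\<^sup>+\<omega>. ennreal (K * (real (Suc n) * A n \<omega>)) \<partial>P) = ennreal (K * real (Suc n)) * (\<integral>\<^sup>+\<omega>. ennreal (A n \<omega>) \<partial>P)"
        using K by (subst nn_integral_cmult[symmetric]) (auto simp: ennreal_mult'[symmetric] mult.assoc)
      also have "\<dots> \<le> ennreal (K * real (Suc n)) * (ennreal (\<tau> n) * (\<integral>\<^sup>+\<omega>. ennreal (norm (f (Y 0 \<omega>))) \<partial>P))"
        by (intro mult_left_mono A_le) auto
      also have "\<dots> = ennreal (K * (real (Suc n) * \<tau> n)) * (\<integral>\<^sup>+\<omega>. ennreal (norm (f (Y 0 \<omega>))) \<partial>P)"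
        using K \<tau>(2)[of n] by (simp only: mult.assoc[symmetric] ennreal_mult[symmetric] mult_nonneg_nonneg of_nat_0_le_iff)
      also have "\<dots> = (\<integral>\<^sup>+\<omega>. ennreal (K * norm (f (Y 0 \<omega>))) \<partial>P)"
        unfolding \<tau>(3) using K by (subst nn_integral_cmult[symmetric]) (auto simp: ennreal_mult')
      finally show ?thesis .
    qed
  qed (use drift in auto)
  \<comment> \<open>Boundedness of \<open>\<phi>\<close> makes both means finite, so the mean of the
    difference splits.\<close>
  moreover have "(\<integral>\<omega>. real (Suc n) * (\<phi> (Y (\<tau> n) \<omega>) - \<phi> (X n \<omega>)) \<partial>P) =
      real (Suc n) * (expectation (\<lambda>\<omega>. \<phi> (Y 0 \<omega>)) - expectation (\<lambda>\<omega>. \<phi> (X n \<omega>)))" for n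
  proof -
    have "integrable P (\<lambda>\<omega>. \<phi> (Z \<omega>))" if [measurable]: "Z \<in> borel_measurable P" for Z
      using \<phi>_le by (intro integrable_const_bound[where B=K']) auto
    then show ?thesis using expectation_Y[of "\<tau> n" \<phi>] \<tau> by simp
  qed
  ultimately show ?thesis unfolding X_def \<tau>_def by simp
qed

end

text \<open>
  \<open>E \<phi>(Y\<^sub>0 + \<sigma>B\<^sub>t)\<close> depends only on \<open>t\<close> and the law of \<open>Y\<^sub>0\<close>, so the difference quotients of
  \<open>generator_limit\<close> agree for two equations with the same stationary marginal.
\<close>

lemma drift_integrals_agree:
  assumes "stationary_sde P\<^sub>1 B\<^sub>1 \<sigma> f\<^sub>1 Y\<^sub>1 L\<^sub>1" "stationary_sde P\<^sub>2 B\<^sub>2 \<sigma> f\<^sub>2 Y\<^sub>2 L\<^sub>2"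
    and law: "distr P\<^sub>1 borel (Y\<^sub>1 0) = distr P\<^sub>2 borel (Y\<^sub>2 0)"
    and \<phi>: "\<And>x. GDERIV \<phi> x :> g x" and g: "continuous_on UNIV g"
    and g_le: "\<And>x. norm (g x) \<le> K" and \<phi>_le: "\<And>x. \<bar>\<phi> x\<bar> \<le> K'"
    and drift: "integrable (distr P\<^sub>1 borel (Y\<^sub>1 0)) (\<lambda>x. norm (f\<^sub>1 x))"
      "integrable (distr P\<^sub>1 borel (Y\<^sub>1 0)) (\<lambda>x. norm (f\<^sub>2 x))"
  shows "(\<integral>x. g x \<bullet> f\<^sub>1 x \<partial>distr P\<^sub>1 borel (Y\<^sub>1 0)) = (\<integral>x. g x \<bullet> f\<^sub>2 x \<partial>distr P\<^sub>1 borel (Y\<^sub>1 0))"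
proof -
  interpret S1: stationary_sde P\<^sub>1 B\<^sub>1 \<sigma> f\<^sub>1 Y\<^sub>1 L\<^sub>1 by fact
  interpret S2: stationary_sde P\<^sub>2 B\<^sub>2 \<sigma> f\<^sub>2 Y\<^sub>2 L\<^sub>2 by fact
  have "continuous_on UNIV \<phi>"
    using \<phi> by (rule GDERIV_continuous_on)
  then have [measurable]: "\<phi> \<in> borel_measurable borel" by (rule borel_measurable_continuous_onI)
  have [measurable]: "g \<in> borel_measurable borel" using g by (rule borel_measurable_continuous_onI)
  define \<mu> where "\<mu> = distr P\<^sub>1 borel (Y\<^sub>1 0)"
  define q where "q n = real (Suc n) * ((\<integral>x. \<phi> x \<partial>\<mu>) -
    (\<integral>(y, z). \<phi> (y + \<sigma> *v z) \<partial>(\<mu> \<Otimes>\<^sub>M isotropic_gaussian (1 / real (Suc n)))))" for n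
  have "q \<longlonglongrightarrow> (\<integral>x. g x \<bullet> f\<^sub>1 x \<partial>\<mu>)"
    using S1.generator_limit[OF \<phi> g g_le \<phi>_le] drift(1)
    by (simp add: S1.noise_perturbation integral_distr integrable_distr_eq q_def[abs_def] \<mu>_def)
  moreover have "q \<longlonglongrightarrow> (\<integral>x. g x \<bullet> f\<^sub>2 x \<partial>\<mu>)"
    using S2.generator_limit[OF \<phi> g g_le \<phi>_le] drift(2)
    by (simp add: S2.noise_perturbation integral_distr integrable_distr_eq q_def[abs_def] \<mu>_def law)
  ultimately show ?thesis unfolding \<mu>_def by (rule LIMSEQ_unique)
qed

section \<open>Test functions and orthogonality of the drift difference\<close>

lemma GDERIV_unique: "GDERIV f x :> D \<Longrightarrow> GDERIV f x :> D' \<Longrightarrow> D = D'"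
  unfolding gderiv_def
  by (drule (1) has_derivative_unique) (simp add: fun_eq_iff vector_eq_ldot)

lemma GDERIV_gradient:
  fixes f :: "real^'d \<Rightarrow> real"
  assumes "f differentiable (at x)"
  shows "GDERIV f x :> gradient f x"
proof -
  obtain f' where f': "(f has_derivative f') (at x)" using assms by (auto simp: differentiable_def)
  then have "linear f'" by (rule has_derivative_linear)
  \<comment> \<open>Riesz representation: the adjoint of a linear functional, applied to 1, is the
    vector that represents it.\<close>
  then have "f' = (\<lambda>h. h \<bullet> adjoint f' 1)" by (simp add: fun_eq_iff adjoint_works)
  then have D: "GDERIV f x :> adjoint f' 1" using f' by (simp add: gderiv_def)
  show ?thesis
    unfolding gradient_def by (rule theI[where P="\<lambda>D. GDERIV f x :> D", OF D GDERIV_unique[OF _ D]])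
qed

text \<open>These are the properties that \<open>drift_integrals_agree\<close> asks of a test
  function. On the compact support, continuity bounds \<open>\<phi>\<close> and its gradient; the
  complement is open and \<open>\<phi>\<close> vanishes on it, so the gradient vanishes there
  too.\<close>

lemma C2_compact_support:
  fixes \<phi> :: "real^'d \<Rightarrow> real"
  assumes C2: "C2_fun \<phi>" and supp: "compact (closure {x. \<phi> x \<noteq> 0})"
  shows "GDERIV \<phi> x :> gradient \<phi> x" "continuous_on UNIV (gradient \<phi>)"
    "\<exists>K. \<forall>x. norm (gradient \<phi> x) \<le> K" "\<exists>K. \<forall>x. \<bar>\<phi> x\<bar> \<le> K"
proof -
  show G: "GDERIV \<phi> x :> gradient \<phi> x" for x using C2 by (intro GDERIV_gradient) (simp add: C2_fun_def)
  obtain H where "\<And>x. (gradient \<phi> has_derivative blinfun_apply (H x)) (at x)"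
    using C2 by (auto simp: C2_fun_def)
  then show cont: "continuous_on UNIV (gradient \<phi>)"
    by (intro has_derivative_continuous_on[where f'="\<lambda>x. blinfun_apply (H x)"]) simp
  have cont': "continuous_on UNIV \<phi>"
    using G by (rule GDERIV_continuous_on)
  define S where "S = closure {x. \<phi> x \<noteq> 0}"
  have S: "closed S" by (simp add: S_def)
  have zero: "\<phi> x = 0" if "x \<notin> S" for x using that closure_subset[of "{x. \<phi> x \<noteq> 0}"] unfolding S_def by blast
  have grad_zero: "gradient \<phi> x = 0" if "x \<notin> S" for x
  proof (rule GDERIV_unique[OF G])
    have "((\<lambda>x. 0) has_derivative (\<lambda>h. 0)) (at x)" by simp
    then have "(\<phi> has_derivative (\<lambda>h. 0)) (at x)"
      by (rule has_derivative_transform_within_open[where s="- S"]) (simp_all add: S that zero open_Compl)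
    then show "GDERIV \<phi> x :> 0" by (simp add: gderiv_def)
  qed
  have "bounded (gradient \<phi> ` S)" "bounded (\<phi> ` S)"
    using supp continuous_on_subset[OF cont subset_UNIV] continuous_on_subset[OF cont' subset_UNIV]
    unfolding S_def[symmetric] by (simp_all only: compact_imp_bounded compact_continuous_image)
  then obtain K K' where K: "0 < K" "\<And>x. x \<in> S \<Longrightarrow> norm (gradient \<phi> x) \<le> K"
    and K': "0 < K'" "\<And>x. x \<in> S \<Longrightarrow> \<bar>\<phi> x\<bar> \<le> K'"
    by (auto simp: bounded_pos)
  have "norm (gradient \<phi> x) \<le> K" for x using K grad_zero[of x] by (cases "x \<in> S") auto
  then show "\<exists>K. \<forall>x. norm (gradient \<phi> x) \<le> K" by blast
  have "\<bar>\<phi> x\<bar> \<le> K'" for x using K' zero[of x] by (cases "x \<in> S") auto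
  then show "\<exists>K. \<forall>x. \<bar>\<phi> x\<bar> \<le> K" by blast
qed

text \<open>Membership in \<open>L2_orthogonal\<close> includes square integrability, which comes
  from the linear growth of Lipschitz drifts and the second moment. The pairing with a single
  gradient vanishes by \<open>drift_integrals_agree\<close>, and linearity extends this to the
  span.\<close>

lemma drift_difference_orthogonal:
  fixes f\<^sub>1 f\<^sub>2 :: "real^'d \<Rightarrow> real^'d"
  assumes "stationary_sde P\<^sub>1 B\<^sub>1 \<sigma> f\<^sub>1 Y\<^sub>1 L\<^sub>1" "stationary_sde P\<^sub>2 B\<^sub>2 \<sigma> f\<^sub>2 Y\<^sub>2 L\<^sub>2"
    and law: "distr P\<^sub>1 borel (Y\<^sub>1 0) = distr P\<^sub>2 borel (Y\<^sub>2 0)"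
    and moment: "integrable (distr P\<^sub>1 borel (Y\<^sub>1 0)) (\<lambda>x. (norm x)\<^sup>2)"
  shows "(\<lambda>x. f\<^sub>1 x - f\<^sub>2 x) \<in> L2_orthogonal (distr P\<^sub>1 borel (Y\<^sub>1 0)) grad_space"
proof -
  interpret S1: stationary_sde P\<^sub>1 B\<^sub>1 \<sigma> f\<^sub>1 Y\<^sub>1 L\<^sub>1 by fact
  interpret S2: stationary_sde P\<^sub>2 B\<^sub>2 \<sigma> f\<^sub>2 Y\<^sub>2 L\<^sub>2 by fact
  define \<mu> where "\<mu> = distr P\<^sub>1 borel (Y\<^sub>1 0)"
  interpret \<mu>: prob_space \<mu> unfolding \<mu>_def by (rule S1.prob_space_distr) simp
  have sets_\<mu> [measurable_cong]: "sets \<mu> = sets borel" by (simp add: \<mu>_def)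
  \<comment> \<open>Stated for any Lipschitz function because it is applied to both drifts and, with
    constant \<open>L\<^sub>1 + L\<^sub>2\<close>, to their difference.\<close>
  have growth: "integrable \<mu> (\<lambda>x. (norm (f x))\<^sup>2)" "integrable \<mu> (\<lambda>x. norm (f x))"
    if lip: "\<And>x y. norm (f x - f y) \<le> L * norm (x - y)" and [measurable]: "f \<in> borel_measurable borel"
    for f :: "real^'d \<Rightarrow> real^'d" and L
  proof -
    have sq: "(norm (f x))\<^sup>2 \<le> 2 * (norm (f 0))\<^sup>2 + 2 * L\<^sup>2 * (norm x)\<^sup>2" for x
    proof -
      have "norm (f x) \<le> norm (f 0) + L * norm x"
        using lip[of x 0] norm_triangle_sub[of "f x" "f 0"] by simp
      then have "(norm (f x))\<^sup>2 \<le> (norm (f 0) + L * norm x)\<^sup>2" by (rule power_mono) simp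
      also have "\<dots> \<le> 2 * (norm (f 0))\<^sup>2 + 2 * (L * norm x)\<^sup>2"
        using sum_squares_bound[of "norm (f 0)" "L * norm x"] by (simp add: power2_sum)
      finally show ?thesis by (simp add: power_mult_distrib)
    qed
    show int: "integrable \<mu> (\<lambda>x. (norm (f x))\<^sup>2)"
    proof (rule Bochner_Integration.integrable_bound)
      show "integrable \<mu> (\<lambda>x. 2 * (norm (f 0))\<^sup>2 + 2 * L\<^sup>2 * (norm x)\<^sup>2)"
        using moment by (simp add: \<mu>_def[symmetric])
      show "AE x in \<mu>. norm ((norm (f x))\<^sup>2) \<le> norm (2 * (norm (f 0))\<^sup>2 + 2 * L\<^sup>2 * (norm x)\<^sup>2)"
        using sq by (intro AE_I2) (simp add: abs_of_nonneg)
    qed simp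
    show "integrable \<mu> (\<lambda>x. norm (f x))"
    proof (rule Bochner_Integration.integrable_bound)
      show "integrable \<mu> (\<lambda>x. 1 + (norm (f x))\<^sup>2)" using int by simp
      have "t \<le> 1 + t\<^sup>2" for t :: real
        using sum_squares_bound[of 1 t] by (simp add: power2_eq_square) (smt (verit) zero_le_square)
      then show "AE x in \<mu>. norm (norm (f x)) \<le> norm (1 + (norm (f x))\<^sup>2)"
        by (intro AE_I2) (simp add: abs_of_nonneg)
    qed simp
  qed
  note f_int = growth(2)[OF S1.lipschitz S1.f_measurable] growth(2)[OF S2.lipschitz S2.f_measurable]
  have "norm ((f\<^sub>1 x - f\<^sub>2 x) - (f\<^sub>1 y - f\<^sub>2 y)) \<le> (L\<^sub>1 + L\<^sub>2) * norm (x - y)" for x y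
  proof -
    have "norm ((f\<^sub>1 x - f\<^sub>2 x) - (f\<^sub>1 y - f\<^sub>2 y)) = norm ((f\<^sub>1 x - f\<^sub>1 y) - (f\<^sub>2 x - f\<^sub>2 y))"
      by (simp add: algebra_simps)
    also have "\<dots> \<le> norm (f\<^sub>1 x - f\<^sub>1 y) + norm (f\<^sub>2 x - f\<^sub>2 y)" by (rule norm_triangle_ineq4)
    also have "\<dots> \<le> (L\<^sub>1 + L\<^sub>2) * norm (x - y)"
      using S1.lipschitz[of x y] S2.lipschitz[of x y] by (simp add: distrib_right)
    finally show ?thesis .
  qed
  then have L2: "(\<lambda>x. f\<^sub>1 x - f\<^sub>2 x) \<in> L2_space \<mu>"
    unfolding L2_space_def using growth(1)[of "\<lambda>x. f\<^sub>1 x - f\<^sub>2 x" "L\<^sub>1 + L\<^sub>2"] by simp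
  \<comment> \<open>Integrability is recorded along with the value because exchanging the integral
    with a finite sum below relies on it.\<close>
  have grad: "integrable \<mu> (\<lambda>x. (f\<^sub>1 x - f\<^sub>2 x) \<bullet> g x) \<and> (\<integral>x. (f\<^sub>1 x - f\<^sub>2 x) \<bullet> g x \<partial>\<mu>) = 0"
    if g: "g \<in> {gradient \<phi> | \<phi>. C2_fun \<phi> \<and> compact (closure {x. \<phi> x \<noteq> 0})}" for g
  proof -
    from g obtain \<phi> where \<phi>: "g = gradient \<phi>" "C2_fun \<phi>" "compact (closure {x. \<phi> x \<noteq> 0})" by blast
    note test = C2_compact_support[OF \<phi>(2,3), folded \<phi>(1)]
    obtain K K' where K: "\<And>x. norm (g x) \<le> K" and K': "\<And>x. \<bar>\<phi> x\<bar> \<le> K'"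
      using test(3,4) by blast
    have [measurable]: "g \<in> borel_measurable borel" using test(2) by (rule borel_measurable_continuous_onI)
    have int: "integrable \<mu> (\<lambda>x. g x \<bullet> f x)"
      if "integrable \<mu> (\<lambda>x. norm (f x))" and [measurable]: "f \<in> borel_measurable borel" for f
    proof (rule Bochner_Integration.integrable_bound)
      show "integrable \<mu> (\<lambda>x. K * norm (f x))" using that by simp
      have "\<bar>g x \<bullet> f x\<bar> \<le> \<bar>K * norm (f x)\<bar>" for x
        using Cauchy_Schwarz_ineq2[of "g x" "f x"] mult_right_mono[OF K[of x] norm_ge_zero[of "f x"]]
        by linarith
      then show "AE x in \<mu>. norm (g x \<bullet> f x) \<le> norm (K * norm (f x))" by (intro AE_I2) simp
    qed simp
    note ints = int[OF f_int(1) S1.f_measurable] int[OF f_int(2) S2.f_measurable]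
    have "(\<integral>x. g x \<bullet> f\<^sub>1 x \<partial>\<mu>) = (\<integral>x. g x \<bullet> f\<^sub>2 x \<partial>\<mu>)"
      unfolding \<mu>_def
      by (rule drift_integrals_agree[OF assms(1,2) law test(1,2) K K' f_int[unfolded \<mu>_def]])
    then show ?thesis using ints by (simp add: inner_commute[of _ "g _"] inner_diff_right)
  qed
  have "(\<integral>x. (f\<^sub>1 x - f\<^sub>2 x) \<bullet> h x \<partial>\<mu>) = 0" if "h \<in> grad_space" for h
  proof -
    from that obtain T c where T: "finite T" "T \<subseteq> {gradient \<phi> | \<phi>. C2_fun \<phi> \<and> compact (closure {x. \<phi> x \<noteq> 0})}"
      and h: "h = (\<lambda>x. \<Sum>g\<in>T. c g *\<^sub>R g x)"
      unfolding grad_space_def fun_span_def by blast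
    have "(\<integral>x. (f\<^sub>1 x - f\<^sub>2 x) \<bullet> h x \<partial>\<mu>) = (\<integral>x. (\<Sum>g\<in>T. c g * ((f\<^sub>1 x - f\<^sub>2 x) \<bullet> g x)) \<partial>\<mu>)"
      by (simp add: h inner_sum_right)
    also have "\<dots> = (\<Sum>g\<in>T. \<integral>x. c g * ((f\<^sub>1 x - f\<^sub>2 x) \<bullet> g x) \<partial>\<mu>)"
      using T grad by (intro Bochner_Integration.integral_sum integrable_mult_right) blast
    also have "\<dots> = 0"
      using T grad by (intro sum.neutral ballI) (simp add: subset_eq)
    finally show ?thesis .
  qed
  with L2 show ?thesis by (simp add: L2_orthogonal_def \<mu>_def)
qed

theorem proposition6p1:
  fixes \<sigma> :: "real^'d^'d"
    and \<Theta> :: "(real^'q) set"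
    and \<theta>\<^sub>0 :: "real^'q"
    and b :: "real^'q \<Rightarrow> real^'d \<Rightarrow> real^'d"
    and P :: "real^'q \<Rightarrow> 'w measure"
    and B Y :: "real^'q \<Rightarrow> real \<Rightarrow> 'w \<Rightarrow> real^'d"
    and \<nu> :: "real^'q \<Rightarrow> (real^'d) measure"
    and dst :: "(real^'d) measure \<Rightarrow> (real^'d) measure \<Rightarrow> real"
  assumes "invertible \<sigma>"
    and "compact \<Theta>"
    and "\<theta>\<^sub>0 \<in> \<Theta>"
    and "weak_coercivity \<Theta> b"
    and "\<And>\<theta>. \<theta> \<in> \<Theta> \<Longrightarrow> stationary_solution (P \<theta>) (B \<theta>) \<sigma> (b \<theta>) (Y \<theta>)"
    and "\<And>\<theta>. \<theta> \<in> \<Theta> \<Longrightarrow> \<nu> \<theta> = distr (P \<theta>) borel (Y \<theta> 0)"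
    and "distance_on_prob dst"
  shows "(\<forall>\<theta>\<^sub>1\<in>\<Theta>. \<forall>\<theta>\<^sub>2\<in>\<Theta>.
            (\<lambda>x. b \<theta>\<^sub>1 x - b \<theta>\<^sub>2 x) \<notin> L2_orthogonal (\<nu> \<theta>\<^sub>1) grad_space \<longrightarrow>
            dst (\<nu> \<theta>\<^sub>1) (\<nu> \<theta>\<^sub>2) > 0) \<and>
         ((\<forall>\<theta>\<^sub>1\<in>\<Theta>. \<forall>\<theta>\<^sub>2\<in>\<Theta>. \<theta>\<^sub>1 \<noteq> \<theta>\<^sub>2 \<longrightarrow>
            (\<lambda>x. b \<theta>\<^sub>1 x - b \<theta>\<^sub>2 x) \<notin> L2_orthogonal (\<nu> \<theta>\<^sub>1) grad_space) \<longrightarrow>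
          (\<forall>\<theta>\<in>\<Theta>. \<nu> \<theta> = \<nu> \<theta>\<^sub>0 \<longleftrightarrow> \<theta> = \<theta>\<^sub>0))"
proof -
  \<comment> \<open>The constants of the coercivity condition are uniform over \<Theta>, so one
    \<open>L\<close> serves every instance of the locale.\<close>
  obtain \<alpha> \<beta> L :: real where pos: "0 < \<alpha>" "0 < \<beta>" "0 < L"
    and diss: "\<And>\<theta> x y. \<theta> \<in> \<Theta> \<Longrightarrow> (b \<theta> x - b \<theta> y) \<bullet> (x - y) \<le> \<beta> - \<alpha> * (norm (x - y))\<^sup>2"
    and lip: "\<And>\<theta> x y. \<theta> \<in> \<Theta> \<Longrightarrow> norm (b \<theta> x - b \<theta> y) \<le> L * norm (x - y)"
    using assms(4) unfolding weak_coercivity_def by metis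
  have sde: "stationary_sde (P \<theta>) (B \<theta>) \<sigma> (b \<theta>) (Y \<theta>) L" if "\<theta> \<in> \<Theta>" for \<theta>
  proof -
    have "prob_space (P \<theta>)"
      using assms(5)[OF that] by (simp add: stationary_solution_def sde_solution_def brownian_motion_def)
    then show ?thesis
      using assms(5)[OF that] lip[OF that] pos by (simp add: stationary_sde_def stationary_sde_axioms_def)
  qed
  \<comment> \<open>\<open>dst\<close> is a metric on the Borel probability measures, so its axioms
    apply to \<open>\<nu> \<theta>\<close> only through this membership.\<close>
  have prob: "\<nu> \<theta> \<in> space (prob_algebra borel)" if "\<theta> \<in> \<Theta>" for \<theta>
  proof -
    interpret stationary_sde "P \<theta>" "B \<theta>" \<sigma> "b \<theta>" "Y \<theta>" L using sde[OF that] .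
    show ?thesis using prob_space_distr[of "Y \<theta> 0" borel] by (simp add: assms(6)[OF that] space_prob_algebra)
  qed
  have moment: "integrable (distr (P \<theta>) borel (Y \<theta> 0)) (\<lambda>x. (norm x)\<^sup>2)" if "\<theta> \<in> \<Theta>" for \<theta>
  proof -
    interpret stationary_sde "P \<theta>" "B \<theta>" \<sigma> "b \<theta>" "Y \<theta>" L using sde[OF that] .
    show ?thesis using second_moment[OF diss[OF that] pos(1,2)] by (subst integrable_distr_eq) simp_all
  qed
  \<comment> \<open>Contrapositive of \<open>drift_difference_orthogonal\<close>: equal marginals
    would put the drift difference into the orthogonal complement.\<close>
  have distinct: "\<nu> \<theta>\<^sub>1 \<noteq> \<nu> \<theta>\<^sub>2"
    if \<theta>: "\<theta>\<^sub>1 \<in> \<Theta>" "\<theta>\<^sub>2 \<in> \<Theta>"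
      and "(\<lambda>x. b \<theta>\<^sub>1 x - b \<theta>\<^sub>2 x) \<notin> L2_orthogonal (\<nu> \<theta>\<^sub>1) grad_space" for \<theta>\<^sub>1 \<theta>\<^sub>2
    using that drift_difference_orthogonal[OF sde[OF \<theta>(1)] sde[OF \<theta>(2)] _ moment[OF \<theta>(1)]]
      assms(6)[OF \<theta>(1)] assms(6)[OF \<theta>(2)] by metis
  have metric: "Metric_space (space (prob_algebra borel)) dst"
    using assms(7) by (simp add: distance_on_prob_def)
  have pos_dist: "0 < dst (\<nu> \<theta>\<^sub>1) (\<nu> \<theta>\<^sub>2)" if "\<theta>\<^sub>1 \<in> \<Theta>" "\<theta>\<^sub>2 \<in> \<Theta>" "\<nu> \<theta>\<^sub>1 \<noteq> \<nu> \<theta>\<^sub>2" for \<theta>\<^sub>1 \<theta>\<^sub>2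
    using that prob by (intro Metric_space.mdist_pos_less[OF metric]) auto
  show ?thesis
  proof (intro conjI ballI impI)
    show "0 < dst (\<nu> \<theta>\<^sub>1) (\<nu> \<theta>\<^sub>2)"
      if "\<theta>\<^sub>1 \<in> \<Theta>" "\<theta>\<^sub>2 \<in> \<Theta>"
        "(\<lambda>x. b \<theta>\<^sub>1 x - b \<theta>\<^sub>2 x) \<notin> L2_orthogonal (\<nu> \<theta>\<^sub>1) grad_space" for \<theta>\<^sub>1 \<theta>\<^sub>2
      using that by (intro pos_dist distinct)
    \<comment> \<open>From right to left this is immediate; for the other direction, a parameter
      different from \<open>\<theta>\<^sub>0\<close> has a different measure by
      \<open>distinct\<close>.\<close>
    show "\<nu> \<theta> = \<nu> \<theta>\<^sub>0 \<longleftrightarrow> \<theta> = \<theta>\<^sub>0"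
      if "\<forall>\<theta>\<^sub>1\<in>\<Theta>. \<forall>\<theta>\<^sub>2\<in>\<Theta>. \<theta>\<^sub>1 \<noteq> \<theta>\<^sub>2 \<longrightarrow>
          (\<lambda>x. b \<theta>\<^sub>1 x - b \<theta>\<^sub>2 x) \<notin> L2_orthogonal (\<nu> \<theta>\<^sub>1) grad_space"
        and "\<theta> \<in> \<Theta>" for \<theta>
      using that distinct[of \<theta> \<theta>\<^sub>0] assms(3) by blast
  qed
qed

end
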